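(* Let $(\mathcal A,F,\Phi)$ be a quasi-bimonad in a 2-category $\mathcal K$ (a 0-cell of $\mathrm{QB}(\mathcal K)$). Then the category ${}_{(\mathcal A,F,\Phi)}\mathcal T$ of left Tambara modules over it is a (non-strict) monoidal category, where: (1) the unit object is $(\mathrm{Id}_{\mathcal A},\mathrm{id}_F)$ with the trivial $F$-action $\varepsilon:F\to \mathrm{Id}_{\mathcal A}$; (2) the tensor product of $(X,\tau_{F,X},\nu_X)$ and $(Y,\tau_{F,Y},\nu_Y)$ is $XY$ with $\tau_{F,XY}=(X\times\tau_{F,Y})\circ(\tau_{F,X}\times Y)$ and left $F$-action $(\nu_X\times\nu_Y)\circ(F\times\tau_{F,X}\times Y)\circ(\Delta\times X\times Y)$; (3) the unit constraints are identities; (4) the associativity constraint $\alpha_{X,Y,Z}:(XY)Z\to X(YZ)$ is $$\alpha_{X,Y,Z}=(\nu_X\times\nu_Y\times\nu_Z)\circ(F\times\tau_{F,X}\times\tau_{F,Y}\times Z)\circ(F\times F\times\tau_{F,X}\times Y\times Z)\circ(\Phi\times X\times Y\times Z).$$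
   Context: Conventions. 1-cells are composed by juxtaposition ($YX$ for $X:\mathcal A\to\mathcal A'$, $Y:\mathcal A'\to\mathcal A''$); $\times$ is horizontal and $\circ$ vertical composition of 2-cells; a 1-cell in a formula stands for its identity 2-cell; $F^n=F\cdots F$. A monad $F:\mathcal A\to\mathcal A$ has multiplication $\mu$ and unit $\eta$; a left $F$-module is a 1-cell $X$ with an associative unital 2-cell $\nu:FX\to X$; a 2-cell $\zeta:X\to Y$ between left modules is left $F$-linear if $\zeta\circ\nu_X=\nu_Y\circ(F\times\zeta)$. Distributive laws. For $F:\mathcal A\to\mathcal A$ with 2-cells $\mu:FF\to F$, $\eta:\mathrm{Id}_{\mathcal A}\to F$, $\Delta:F\to FF$, $\varepsilon:F\to\mathrm{Id}_{\mathcal A}$, a 2-cell $\tau:FF\to FF$ is: left monadic if $\tau(\mu\times F)=(F\times\mu)(\tau\times F)(F\times\tau)$, $\tau(\eta\times F)=F\times\eta$; right monadic if $\tau(F\times\mu)=(\mu\times F)(F\times\tau)(\tau\times F)$, $\tau(F\times\eta)=\eta\times F$; left comonadic if $(\Delta\times F)\tau=(F\times\tau)(\tau\times F)(F\times\Delta)$, $(\varepsilon\times F)\tau=F\times\varepsilon$; right comonadic if $(F\times\Delta)\tau=(\tau\times F)(F\times\tau)(\Delta\times F)$, $(F\times\varepsilon)\tau=\varepsilon\times F$. A quasi-bimonad is $(\mathcal A,F,\mu,\eta,\Delta,\varepsilon,\tau,\Phi)$, $\tau=\tau_{F,F}$, where $(\mathcal A,F,\mu,\eta)$ is a monad, $\tau:FF\to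 FF$ is left and right monadic and left and right comonadic, and $(\varepsilon\times F)\Delta=F=(F\times\varepsilon)\Delta$, $\Delta\mu=(\mu\times\mu)(F\times\tau\times F)(\Delta\times\Delta)$, $\Delta\eta=\eta\times\eta$, $\varepsilon\mu=\varepsilon\times\varepsilon$, $\varepsilon\eta=\mathrm{Id}_{\mathrm{id}_{\mathcal A}}$. The 1-cell $FFF$ carries the multiplication $\mu_{FFF}=(\mu\times\mu\times\mu)(F\times\tau\times\tau\times F)(F^2\times\tau\times F^2)$; the 2-cell $\Phi:\mathrm{Id}_{\mathcal A}\to FFF$ is invertible for the convolution product $\Psi*\Psi'=\mu_{FFF}(\Psi\times\Psi')$ with unit $\eta\times\eta\times\eta$, is normalized, $(F\times\varepsilon\times F)\Phi=\eta\times\eta$, and satisfies (quasi coassociativity) $(\mu\times\mu\times F)(F\times\tau\times F^2)(F^2\times\Delta\times\mu)(F^2\times\tau\times F)(\Phi\times\Delta)=\mu_{FFF}\circ\big((F\times\Delta)\Delta\times\Phi\big)$, i.e. $\Phi\cdot(\Delta\times F)\Delta=(F\times\Delta)\Delta\cdot\Phi$; (3-cocycle condition) $$(F\times\mu\times\mu\times F)(F^2\times\tau\times F^2)(F\times\mu\times\mu\times F\times\tau)(F^2\times\tau\times F\times\tau\times F)(F^3\times\Delta\times\mu\times F^2)(F^3\times\tau\times F^3)(F\times\Phi\times F^4)(\mu\times F^4)(F\times\tau\times F^3)(F^2\times\tau\times F^2)(\Phi\times\Phi)$$ $$=(\mu\times\mu\times\mu\times\mu)(F\times\tau\times F^2\times\tau\times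 F)(F^2\times\Delta\times\Delta\times F^2)(F^2\times\tau\times F^2)(\Phi\times\Phi).$$ The quasi-bimonad is a 0-cell of $\mathrm{QB}(\mathcal K)$ if moreover $\Phi\times F=(F^2\times\tau)(F\times\tau\times F)(\tau\times F^2)(F\times\Phi)$. The category $\mathrm{QB}(\mathcal K)(F)$ has objects $(X,\tau_{F,X})$, $X:\mathcal A\to\mathcal A$, $\tau_{F,X}:FX\to XF$, with $\tau_{F,X}(\mu\times X)=(X\times\mu)(\tau_{F,X}\times F)(F\times\tau_{F,X})$, $\tau_{F,X}(\eta\times X)=X\times\eta$; $(X\times\Delta)\tau_{F,X}=(\tau_{F,X}\times F)(F\times\tau_{F,X})(\Delta\times X)$, $(X\times\varepsilon)\tau_{F,X}=\varepsilon\times X$; $X\times\Phi=(\tau_{F,X}\times F^2)(F\times\tau_{F,X}\times F)(F^2\times\tau_{F,X})(\Phi\times X)$; $(X\times\tau)(\tau_{F,X}\times F)(F\times\tau_{F,X})=(\tau_{F,X}\times F)(F\times\tau_{F,X})(\tau\times X)$. Its morphisms $(X,\tau_{F,X})\to(Y,\tau_{F,Y})$ are 2-cells $\zeta:X\to Y$ with $(\zeta\times F)\tau_{F,X}=\tau_{F,Y}(F\times\zeta)$. The category ${}_{(\mathcal A,F,\Phi)}\mathcal T$ of left Tambara modules has objects $(X,\tau_{F,X},\nu)$ with $(X,\tau_{F,X})\in\mathrm{QB}(\mathcal K)(F)$, $(X,\nu)$ a left $F$-module and $\nu:(FX,\tau_{F,FX})\to(X,\tau_{F,X})$ a morphism in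 $\mathrm{QB}(\mathcal K)(F)$, where $\tau_{F,FX}=(F\times\tau_{F,X})(\tau\times X)$; that is, $\tau_{F,X}(F\times\nu)=(\nu\times F)(F\times\tau_{F,X})(\tau\times X)$. Morphisms are left $F$-linear morphisms in $\mathrm{QB}(\mathcal K)(F)$. *)

theory Defs
  imports Main
begin

section \<open>Categories and monoidal categories\<close>

text \<open>
  Hom-sets are indexed by objects and need not be disjoint; composition and the other
  operations are only constrained on arguments of the right type.
\<close>

record ('o, 'a) cat =
  Ob :: "'o set"
  Hom :: "'o \<Rightarrow> 'o \<Rightarrow> 'a set"
  Comp :: "'a \<Rightarrow> 'a \<Rightarrow> 'a" (infixr "\<odot>\<index>" 65)
  Id :: "'o \<Rightarrow> 'a"

locale category =
  fixes C :: "('o, 'a) cat" (structure)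
  assumes Id_closed: "X \<in> Ob C \<Longrightarrow> Id C X \<in> Hom C X X"
    and Comp_closed:
      "\<lbrakk>X \<in> Ob C; Y \<in> Ob C; Z \<in> Ob C; g \<in> Hom C Y Z; f \<in> Hom C X Y\<rbrakk> \<Longrightarrow> g \<odot> f \<in> Hom C X Z"
    and Id_left: "\<lbrakk>X \<in> Ob C; Y \<in> Ob C; f \<in> Hom C X Y\<rbrakk> \<Longrightarrow> Id C Y \<odot> f = f"
    and Id_right: "\<lbrakk>X \<in> Ob C; Y \<in> Ob C; f \<in> Hom C X Y\<rbrakk> \<Longrightarrow> f \<odot> Id C X = f"
    and Comp_assoc:
      "\<lbrakk>W \<in> Ob C; X \<in> Ob C; Y \<in> Ob C; Z \<in> Ob C;
        h \<in> Hom C Y Z; g \<in> Hom C X Y; f \<in> Hom C W X\<rbrakk>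
       \<Longrightarrow> (h \<odot> g) \<odot> f = h \<odot> (g \<odot> f)"

definition isos :: "('o, 'a) cat \<Rightarrow> 'o \<Rightarrow> 'o \<Rightarrow> 'a set" where
  "isos C X Y = {f \<in> Hom C X Y. \<exists>g \<in> Hom C Y X. Comp C g f = Id C X \<and> Comp C f g = Id C Y}"

locale monoidal_category = category C
  for C :: "('o, 'a) cat" (structure) +
  fixes tens0 :: "'o \<Rightarrow> 'o \<Rightarrow> 'o" (infixr "\<boxtimes>\<^sub>0" 70)
    and tens1 :: "'a \<Rightarrow> 'a \<Rightarrow> 'a" (infixr "\<boxtimes>\<^sub>1" 70)
    and unit :: 'o
    and assoc :: "'o \<Rightarrow> 'o \<Rightarrow> 'o \<Rightarrow> 'a"
    and lunit :: "'o \<Rightarrow> 'a"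
    and runit :: "'o \<Rightarrow> 'a"
  assumes tens0_closed: "\<lbrakk>X \<in> Ob C; Y \<in> Ob C\<rbrakk> \<Longrightarrow> X \<boxtimes>\<^sub>0 Y \<in> Ob C"
    and tens1_closed:
      "\<lbrakk>X \<in> Ob C; X' \<in> Ob C; Y \<in> Ob C; Y' \<in> Ob C; f \<in> Hom C X X'; g \<in> Hom C Y Y'\<rbrakk>
       \<Longrightarrow> f \<boxtimes>\<^sub>1 g \<in> Hom C (X \<boxtimes>\<^sub>0 Y) (X' \<boxtimes>\<^sub>0 Y')"
    and tens1_Id: "\<lbrakk>X \<in> Ob C; Y \<in> Ob C\<rbrakk> \<Longrightarrow> Id C X \<boxtimes>\<^sub>1 Id C Y = Id C (X \<boxtimes>\<^sub>0 Y)"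
    and tens1_Comp:
      "\<lbrakk>X \<in> Ob C; X' \<in> Ob C; X'' \<in> Ob C; Y \<in> Ob C; Y' \<in> Ob C; Y'' \<in> Ob C;
        f \<in> Hom C X X'; f' \<in> Hom C X' X''; g \<in> Hom C Y Y'; g' \<in> Hom C Y' Y''\<rbrakk>
       \<Longrightarrow> (f' \<odot> f) \<boxtimes>\<^sub>1 (g' \<odot> g) = (f' \<boxtimes>\<^sub>1 g') \<odot> (f \<boxtimes>\<^sub>1 g)"
    and unit_closed: "unit \<in> Ob C"
    and assoc_iso:
      "\<lbrakk>X \<in> Ob C; Y \<in> Ob C; Z \<in> Ob C\<rbrakk>
       \<Longrightarrow> assoc X Y Z \<in> isos C ((X \<boxtimes>\<^sub>0 Y) \<boxtimes>\<^sub>0 Z) (X \<boxtimes>\<^sub>0 (Y \<boxtimes>\<^sub>0 Z))"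
    and assoc_natural:
      "\<lbrakk>X \<in> Ob C; X' \<in> Ob C; Y \<in> Ob C; Y' \<in> Ob C; Z \<in> Ob C; Z' \<in> Ob C;
        f \<in> Hom C X X'; g \<in> Hom C Y Y'; h \<in> Hom C Z Z'\<rbrakk>
       \<Longrightarrow> assoc X' Y' Z' \<odot> ((f \<boxtimes>\<^sub>1 g) \<boxtimes>\<^sub>1 h) = (f \<boxtimes>\<^sub>1 (g \<boxtimes>\<^sub>1 h)) \<odot> assoc X Y Z"
    and lunit_iso: "X \<in> Ob C \<Longrightarrow> lunit X \<in> isos C (unit \<boxtimes>\<^sub>0 X) X"
    and lunit_natural:
      "\<lbrakk>X \<in> Ob C; Y \<in> Ob C; f \<in> Hom C X Y\<rbrakk> \<Longrightarrow> lunit Y \<odot> (Id C unit \<boxtimes>\<^sub>1 f) = f \<odot> lunit X"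
    and runit_iso: "X \<in> Ob C \<Longrightarrow> runit X \<in> isos C (X \<boxtimes>\<^sub>0 unit) X"
    and runit_natural:
      "\<lbrakk>X \<in> Ob C; Y \<in> Ob C; f \<in> Hom C X Y\<rbrakk> \<Longrightarrow> runit Y \<odot> (f \<boxtimes>\<^sub>1 Id C unit) = f \<odot> runit X"
    and triangle:
      "\<lbrakk>X \<in> Ob C; Y \<in> Ob C\<rbrakk>
       \<Longrightarrow> (Id C X \<boxtimes>\<^sub>1 lunit Y) \<odot> assoc X unit Y = runit X \<boxtimes>\<^sub>1 Id C Y"
    and pentagon:
      "\<lbrakk>W \<in> Ob C; X \<in> Ob C; Y \<in> Ob C; Z \<in> Ob C\<rbrakk>
       \<Longrightarrow> assoc W X (Y \<boxtimes>\<^sub>0 Z) \<odot> assoc (W \<boxtimes>\<^sub>0 X) Y Z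
         = (Id C W \<boxtimes>\<^sub>1 assoc X Y Z) \<odot> assoc W (X \<boxtimes>\<^sub>0 Y) Z \<odot> (assoc W X Y \<boxtimes>\<^sub>1 Id C Z)"

section \<open>Strict 2-categories\<close>

text \<open>
  In the notation for compositions the cell applied last stands on the left:
  \<open>Y \<diamond> X : \<A> \<rightarrow> \<A>''\<close> for \<open>X : \<A> \<rightarrow> \<A>'\<close> and \<open>Y : \<A>' \<rightarrow> \<A>''\<close>. Horizontal composition
  of 2-cells is \<open>\<star>\<close>, vertical composition is \<open>\<cdot>\<close> (binding weaker than \<open>\<star>\<close>), and \<open>\<iota> X\<close> is the
  identity 2-cell of \<open>X\<close>.
\<close>

record ('o, 'm, 'c) two_cat =
  Cell0 :: "'o set"
  Cell1 :: "'o \<Rightarrow> 'o \<Rightarrow> 'm set"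
  Cell2 :: "'m \<Rightarrow> 'm \<Rightarrow> 'c set"
  Id1 :: "'o \<Rightarrow> 'm"
  Comp1 :: "'m \<Rightarrow> 'm \<Rightarrow> 'm" (infixr "\<diamond>\<index>" 75)
  Id2 :: "'m \<Rightarrow> 'c" ("\<iota>\<index>")
  VComp :: "'c \<Rightarrow> 'c \<Rightarrow> 'c" (infixr "\<cdot>\<index>" 65)
  HComp :: "'c \<Rightarrow> 'c \<Rightarrow> 'c" (infixr "\<star>\<index>" 70)

definition hom_cat :: "('o, 'm, 'c) two_cat \<Rightarrow> 'o \<Rightarrow> 'o \<Rightarrow> ('m, 'c) cat" where
  "hom_cat K A B = \<lparr>Ob = Cell1 K A B, Hom = Cell2 K, Comp = VComp K, Id = Id2 K\<rparr>"

locale two_category =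
  fixes K :: "('o, 'm, 'c) two_cat" (structure)
  assumes hom_category: "\<lbrakk>A \<in> Cell0 K; B \<in> Cell0 K\<rbrakk> \<Longrightarrow> category (hom_cat K A B)"
    and Id1_closed: "A \<in> Cell0 K \<Longrightarrow> Id1 K A \<in> Cell1 K A A"
    and Comp1_closed:
      "\<lbrakk>A \<in> Cell0 K; B \<in> Cell0 K; C \<in> Cell0 K; X \<in> Cell1 K A B; Y \<in> Cell1 K B C\<rbrakk>
       \<Longrightarrow> Y \<diamond> X \<in> Cell1 K A C"
    and HComp_closed:
      "\<lbrakk>A \<in> Cell0 K; B \<in> Cell0 K; C \<in> Cell0 K;
        X \<in> Cell1 K A B; X' \<in> Cell1 K A B; Y \<in> Cell1 K B C; Y' \<in> Cell1 K B C;
        f \<in> Cell2 K X X'; g \<in> Cell2 K Y Y'\<rbrakk>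
       \<Longrightarrow> g \<star> f \<in> Cell2 K (Y \<diamond> X) (Y' \<diamond> X')"
    and HComp_Id2:
      "\<lbrakk>A \<in> Cell0 K; B \<in> Cell0 K; C \<in> Cell0 K; X \<in> Cell1 K A B; Y \<in> Cell1 K B C\<rbrakk>
       \<Longrightarrow> \<iota> Y \<star> \<iota> X = \<iota> (Y \<diamond> X)"
    and interchange:
      "\<lbrakk>A \<in> Cell0 K; B \<in> Cell0 K; C \<in> Cell0 K;
        X \<in> Cell1 K A B; X' \<in> Cell1 K A B; X'' \<in> Cell1 K A B;
        Y \<in> Cell1 K B C; Y' \<in> Cell1 K B C; Y'' \<in> Cell1 K B C;
        f \<in> Cell2 K X X'; f' \<in> Cell2 K X' X''; g \<in> Cell2 K Y Y'; g' \<in> Cell2 K Y' Y''\<rbrakk>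
       \<Longrightarrow> (g' \<cdot> g) \<star> (f' \<cdot> f) = (g' \<star> f') \<cdot> (g \<star> f)"
    and Comp1_assoc:
      "\<lbrakk>A \<in> Cell0 K; B \<in> Cell0 K; C \<in> Cell0 K; D \<in> Cell0 K;
        X \<in> Cell1 K A B; Y \<in> Cell1 K B C; Z \<in> Cell1 K C D\<rbrakk>
       \<Longrightarrow> (Z \<diamond> Y) \<diamond> X = Z \<diamond> (Y \<diamond> X)"
    and HComp_assoc:
      "\<lbrakk>A \<in> Cell0 K; B \<in> Cell0 K; C \<in> Cell0 K; D \<in> Cell0 K;
        X \<in> Cell1 K A B; X' \<in> Cell1 K A B; Y \<in> Cell1 K B C; Y' \<in> Cell1 K B C;
        Z \<in> Cell1 K C D; Z' \<in> Cell1 K C D;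
        f \<in> Cell2 K X X'; g \<in> Cell2 K Y Y'; h \<in> Cell2 K Z Z'\<rbrakk>
       \<Longrightarrow> (h \<star> g) \<star> f = h \<star> (g \<star> f)"
    and Id1_left: "\<lbrakk>A \<in> Cell0 K; B \<in> Cell0 K; X \<in> Cell1 K A B\<rbrakk> \<Longrightarrow> Id1 K B \<diamond> X = X"
    and Id1_right: "\<lbrakk>A \<in> Cell0 K; B \<in> Cell0 K; X \<in> Cell1 K A B\<rbrakk> \<Longrightarrow> X \<diamond> Id1 K A = X"
    and HComp_Id1_left:
      "\<lbrakk>A \<in> Cell0 K; B \<in> Cell0 K; X \<in> Cell1 K A B; X' \<in> Cell1 K A B; f \<in> Cell2 K X X'\<rbrakk>
       \<Longrightarrow> \<iota> (Id1 K B) \<star> f = f"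
    and HComp_Id1_right:
      "\<lbrakk>A \<in> Cell0 K; B \<in> Cell0 K; X \<in> Cell1 K A B; X' \<in> Cell1 K A B; f \<in> Cell2 K X X'\<rbrakk>
       \<Longrightarrow> f \<star> \<iota> (Id1 K A) = f"

section \<open>Quasi-bimonads\<close>

locale quasi_bimonad_data =
  fixes K :: "('o, 'm, 'c) two_cat" (structure)
    and A :: 'o and F :: 'm
    and \<mu> \<eta> \<Delta> \<epsilon> \<tau> \<Phi> :: 'c
begin

abbreviation "F1 \<equiv> \<iota> F"
abbreviation "F2 \<equiv> \<iota> (F \<diamond> F)"
abbreviation "F3 \<equiv> \<iota> (F \<diamond> F \<diamond> F)"
abbreviation "F4 \<equiv> \<iota> (F \<diamond> F \<diamond> F \<diamond> F)"

definition monad :: bool where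
  "monad \<longleftrightarrow>
     A \<in> Cell0 K \<and> F \<in> Cell1 K A A \<and>
     \<mu> \<in> Cell2 K (F \<diamond> F) F \<and> \<eta> \<in> Cell2 K (Id1 K A) F \<and>
     \<mu> \<cdot> (\<mu> \<star> F1) = \<mu> \<cdot> (F1 \<star> \<mu>) \<and>
     \<mu> \<cdot> (\<eta> \<star> F1) = F1 \<and> \<mu> \<cdot> (F1 \<star> \<eta>) = F1"

definition left_monadic :: bool where
  "left_monadic \<longleftrightarrow>
     \<tau> \<cdot> (\<mu> \<star> F1) = (F1 \<star> \<mu>) \<cdot> (\<tau> \<star> F1) \<cdot> (F1 \<star> \<tau>) \<and>
     \<tau> \<cdot> (\<eta> \<star> F1) = F1 \<star> \<eta>"

definition right_monadic :: bool where
  "right_monadic \<longleftrightarrow>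
     \<tau> \<cdot> (F1 \<star> \<mu>) = (\<mu> \<star> F1) \<cdot> (F1 \<star> \<tau>) \<cdot> (\<tau> \<star> F1) \<and>
     \<tau> \<cdot> (F1 \<star> \<eta>) = \<eta> \<star> F1"

definition left_comonadic :: bool where
  "left_comonadic \<longleftrightarrow>
     (\<Delta> \<star> F1) \<cdot> \<tau> = (F1 \<star> \<tau>) \<cdot> (\<tau> \<star> F1) \<cdot> (F1 \<star> \<Delta>) \<and>
     (\<epsilon> \<star> F1) \<cdot> \<tau> = F1 \<star> \<epsilon>"

definition right_comonadic :: bool where
  "right_comonadic \<longleftrightarrow>
     (F1 \<star> \<Delta>) \<cdot> \<tau> = (\<tau> \<star> F1) \<cdot> (F1 \<star> \<tau>) \<cdot> (\<Delta> \<star> F1) \<and>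
     (F1 \<star> \<epsilon>) \<cdot> \<tau> = \<epsilon> \<star> F1"

definition mult3 :: 'c where
  "mult3 = (\<mu> \<star> \<mu> \<star> \<mu>) \<cdot> (F1 \<star> \<tau> \<star> \<tau> \<star> F1) \<cdot> (F2 \<star> \<tau> \<star> F2)"

definition convolution :: "'c \<Rightarrow> 'c \<Rightarrow> 'c" where
  "convolution \<Psi> \<Psi>' = mult3 \<cdot> (\<Psi> \<star> \<Psi>')"

definition convolution_invertible :: "'c \<Rightarrow> bool" where
  "convolution_invertible \<Psi> \<longleftrightarrow>
     (\<exists>\<Psi>' \<in> Cell2 K (Id1 K A) (F \<diamond> F \<diamond> F).
        convolution \<Psi> \<Psi>' = \<eta> \<star> \<eta> \<star> \<eta> \<and> convolution \<Psi>' \<Psi> = \<eta> \<star> \<eta> \<star> \<eta>)"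

definition quasi_coassociative :: bool where
  "quasi_coassociative \<longleftrightarrow>
     (\<mu> \<star> \<mu> \<star> F1) \<cdot> (F1 \<star> \<tau> \<star> F2) \<cdot> (F2 \<star> \<Delta> \<star> \<mu>) \<cdot> (F2 \<star> \<tau> \<star> F1) \<cdot> (\<Phi> \<star> \<Delta>)
     = mult3 \<cdot> (((F1 \<star> \<Delta>) \<cdot> \<Delta>) \<star> \<Phi>)"

definition cocycle3 :: bool where
  "cocycle3 \<longleftrightarrow>
     (F1 \<star> \<mu> \<star> \<mu> \<star> F1) \<cdot> (F2 \<star> \<tau> \<star> F2) \<cdot> (F1 \<star> \<mu> \<star> \<mu> \<star> F1 \<star> \<tau>) \<cdot>
     (F2 \<star> \<tau> \<star> F1 \<star> \<tau> \<star> F1) \<cdot> (F3 \<star> \<Delta> \<star> \<mu> \<star> F2) \<cdot> (F3 \<star> \<tau> \<star> F3) \<cdot>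
     (F1 \<star> \<Phi> \<star> F4) \<cdot> (\<mu> \<star> F4) \<cdot> (F1 \<star> \<tau> \<star> F3) \<cdot> (F2 \<star> \<tau> \<star> F2) \<cdot> (\<Phi> \<star> \<Phi>)
     = (\<mu> \<star> \<mu> \<star> \<mu> \<star> \<mu>) \<cdot> (F1 \<star> \<tau> \<star> F2 \<star> \<tau> \<star> F1) \<cdot>
       (F2 \<star> \<Delta> \<star> \<Delta> \<star> F2) \<cdot> (F2 \<star> \<tau> \<star> F2) \<cdot> (\<Phi> \<star> \<Phi>)"

definition qb_object :: "'m \<Rightarrow> 'c \<Rightarrow> bool" where
  "qb_object X \<sigma> \<longleftrightarrow>
     X \<in> Cell1 K A A \<and> \<sigma> \<in> Cell2 K (F \<diamond> X) (X \<diamond> F) \<and>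
     \<sigma> \<cdot> (\<mu> \<star> \<iota> X) = (\<iota> X \<star> \<mu>) \<cdot> (\<sigma> \<star> F1) \<cdot> (F1 \<star> \<sigma>) \<and>
     \<sigma> \<cdot> (\<eta> \<star> \<iota> X) = \<iota> X \<star> \<eta> \<and>
     (\<iota> X \<star> \<Delta>) \<cdot> \<sigma> = (\<sigma> \<star> F1) \<cdot> (F1 \<star> \<sigma>) \<cdot> (\<Delta> \<star> \<iota> X) \<and>
     (\<iota> X \<star> \<epsilon>) \<cdot> \<sigma> = \<epsilon> \<star> \<iota> X \<and>
     \<iota> X \<star> \<Phi> = (\<sigma> \<star> F2) \<cdot> (F1 \<star> \<sigma> \<star> F1) \<cdot> (F2 \<star> \<sigma>) \<cdot> (\<Phi> \<star> \<iota> X) \<and>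
     (\<iota> X \<star> \<tau>) \<cdot> (\<sigma> \<star> F1) \<cdot> (F1 \<star> \<sigma>) = (\<sigma> \<star> F1) \<cdot> (F1 \<star> \<sigma>) \<cdot> (\<tau> \<star> \<iota> X)"

definition qb_category :: "('m \<times> 'c, 'c) cat" where
  "qb_category =
     \<lparr>Ob = {(X, \<sigma>). qb_object X \<sigma>},
      Hom = (\<lambda>(X, \<sigma>) (Y, \<sigma>'). {\<zeta> \<in> Cell2 K X Y. (\<zeta> \<star> F1) \<cdot> \<sigma> = \<sigma>' \<cdot> (F1 \<star> \<zeta>)}),
      Comp = VComp K,
      Id = (\<lambda>(X, \<sigma>). \<iota> X)\<rparr>"

definition left_module :: "'m \<Rightarrow> 'c \<Rightarrow> bool" where
  "left_module X \<nu> \<longleftrightarrow>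
     X \<in> Cell1 K A A \<and> \<nu> \<in> Cell2 K (F \<diamond> X) X \<and>
     \<nu> \<cdot> (\<mu> \<star> \<iota> X) = \<nu> \<cdot> (F1 \<star> \<nu>) \<and>
     \<nu> \<cdot> (\<eta> \<star> \<iota> X) = \<iota> X"

text \<open>
  The hom-sets of \<open>qb_category\<close> are given by a formula that does not refer to membership of the
  endpoints in \<open>Ob\<close>. The condition on \<open>\<nu>\<close> below is therefore just its type together with
  \<open>\<sigma> \<cdot> (F1 \<star> \<nu>) = (\<nu> \<star> F1) \<cdot> (F1 \<star> \<sigma>) \<cdot> (\<tau> \<star> \<iota> X)\<close>; it does not demand that
  \<open>(F \<diamond> X, (F1 \<star> \<sigma>) \<cdot> (\<tau> \<star> \<iota> X))\<close> be an object.
\<close>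

definition tambara_object :: "'m \<Rightarrow> 'c \<Rightarrow> 'c \<Rightarrow> bool" where
  "tambara_object X \<sigma> \<nu> \<longleftrightarrow>
     (X, \<sigma>) \<in> Ob qb_category \<and> left_module X \<nu> \<and>
     \<nu> \<in> Hom qb_category (F \<diamond> X, (F1 \<star> \<sigma>) \<cdot> (\<tau> \<star> \<iota> X)) (X, \<sigma>)"

definition tambara_category :: "('m \<times> 'c \<times> 'c, 'c) cat" where
  "tambara_category =
     \<lparr>Ob = {(X, \<sigma>, \<nu>). tambara_object X \<sigma> \<nu>},
      Hom = (\<lambda>(X, \<sigma>, \<nu>) (Y, \<sigma>', \<nu>').
        {\<zeta> \<in> Hom qb_category (X, \<sigma>) (Y, \<sigma>'). \<zeta> \<cdot> \<nu> = \<nu>' \<cdot> (F1 \<star> \<zeta>)}),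
      Comp = VComp K,
      Id = (\<lambda>(X, \<sigma>, \<nu>). \<iota> X)\<rparr>"

fun tambara_tensor :: "'m \<times> 'c \<times> 'c \<Rightarrow> 'm \<times> 'c \<times> 'c \<Rightarrow> 'm \<times> 'c \<times> 'c" where
  "tambara_tensor (X, \<sigma>, \<nu>) (Y, \<sigma>', \<nu>') =
     (X \<diamond> Y,
      (\<iota> X \<star> \<sigma>') \<cdot> (\<sigma> \<star> \<iota> Y),
      (\<nu> \<star> \<nu>') \<cdot> (F1 \<star> \<sigma> \<star> \<iota> Y) \<cdot> (\<Delta> \<star> \<iota> X \<star> \<iota> Y))"

definition tambara_unit :: "'m \<times> 'c \<times> 'c" where
  "tambara_unit = (Id1 K A, F1, \<epsilon>)"

fun tambara_assoc ::
  "'m \<times> 'c \<times> 'c \<Rightarrow> 'm \<times> 'c \<times> 'c \<Rightarrow> 'm \<times> 'c \<times> 'c \<Rightarrow> 'c" where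
  "tambara_assoc (X, \<sigma>, \<nu>) (Y, \<sigma>', \<nu>') (Z, \<sigma>'', \<nu>'') =
     (\<nu> \<star> \<nu>' \<star> \<nu>'') \<cdot> (F1 \<star> \<sigma> \<star> \<sigma>' \<star> \<iota> Z) \<cdot> (F1 \<star> F1 \<star> \<sigma> \<star> \<iota> Y \<star> \<iota> Z) \<cdot>
     (\<Phi> \<star> \<iota> X \<star> \<iota> Y \<star> \<iota> Z)"

end

locale quasi_bimonad = two_category K + quasi_bimonad_data K A F \<mu> \<eta> \<Delta> \<epsilon> \<tau> \<Phi>
  for K :: "('o, 'm, 'c) two_cat" (structure) and A F \<mu> \<eta> \<Delta> \<epsilon> \<tau> \<Phi> +
  assumes is_monad: monad
    and \<Delta>_cell: "\<Delta> \<in> Cell2 K F (F \<diamond> F)"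
    and \<epsilon>_cell: "\<epsilon> \<in> Cell2 K F (Id1 K A)"
    and \<tau>_cell: "\<tau> \<in> Cell2 K (F \<diamond> F) (F \<diamond> F)"
    and \<Phi>_cell: "\<Phi> \<in> Cell2 K (Id1 K A) (F \<diamond> F \<diamond> F)"
    and \<tau>_left_monadic: left_monadic
    and \<tau>_right_monadic: right_monadic
    and \<tau>_left_comonadic: left_comonadic
    and \<tau>_right_comonadic: right_comonadic
    and counit_left: "(\<epsilon> \<star> F1) \<cdot> \<Delta> = F1"
    and counit_right: "(F1 \<star> \<epsilon>) \<cdot> \<Delta> = F1"
    and \<Delta>_\<mu>: "\<Delta> \<cdot> \<mu> = (\<mu> \<star> \<mu>) \<cdot> (F1 \<star> \<tau> \<star> F1) \<cdot> (\<Delta> \<star> \<Delta>)"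
    and \<Delta>_\<eta>: "\<Delta> \<cdot> \<eta> = \<eta> \<star> \<eta>"
    and \<epsilon>_\<mu>: "\<epsilon> \<cdot> \<mu> = \<epsilon> \<star> \<epsilon>"
    and \<epsilon>_\<eta>: "\<epsilon> \<cdot> \<eta> = \<iota> (Id1 K A)"
    and \<Phi>_invertible: "convolution_invertible \<Phi>"
    and \<Phi>_normalized: "(F1 \<star> \<epsilon> \<star> F1) \<cdot> \<Phi> = \<eta> \<star> \<eta>"
    and \<Phi>_quasi_coassociative: quasi_coassociative
    and \<Phi>_cocycle: cocycle3

locale qb_zero_cell = quasi_bimonad +
  assumes \<Phi>_\<tau>: "\<Phi> \<star> F1 = (F2 \<star> \<tau>) \<cdot> (F1 \<star> \<tau> \<star> F1) \<cdot> (\<tau> \<star> F2) \<cdot> (F1 \<star> \<Phi>)"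

end

theory Submission
  imports Defs
begin

text \<open>
  Read \<open>\<sigma> : FX \<rightarrow> XF\<close> as a strand \<open>F\<close> crossing \<open>X\<close>. For Tambara modules \<open>X\<^sub>1, \<dots>, X\<^sub>n\<close> the strands of
  \<open>F\<^sup>n\<close> can be moved across so that the \<open>i\<close>-th one acts on \<open>X\<^sub>i\<close>; this is an action of \<open>F\<^sup>n\<close>, with its
  crossed multiplication, on \<open>X\<^sub>1 \<cdots> X\<^sub>n\<close>. The action of \<open>F\<close> on a tensor product of two or three modules is
  the restriction of this action along \<open>\<Delta>\<close> or an iterate of it, and \<open>\<alpha>\<close> is the action of the element \<open>\<Phi>\<close> of \<open>FFF\<close>.
  So \<open>\<alpha>\<close> is invertible because \<open>\<Phi>\<close> is, \<open>F\<close>-linear by quasi-coassociativity, and compatible with the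
  crossings because \<open>\<Phi>\<close> passes through \<open>F\<close>. Both sides of the pentagon are actions of elements of \<open>FFFF\<close>,
  which the 3-cocycle condition identifies.
\<close>

section \<open>Expressions up to interchange\<close>

text \<open>Since \<open>K\<close> is strict, what remains between two uses of an axiom is always
  interchange. The calculations therefore alternate: one axiom is rewritten in place, then the
  2-cell is rearranged until the next axiom becomes visible, and the rearrangement is checked by
  comparing normal forms. Powers of \<open>F\<close> are always split as \<open>F\<close> followed
  by a smaller power \<open>G\<close>. A lemma about a composite \<open>FG\<close> with arbitrary
  \<open>G\<close>, assuming for \<open>G\<close> what it proves for \<open>FG\<close>, then serves
  as the induction step from one module to two, three and four. The \<Phi> of the associativity
  constraint slides past two kinds of 1-cell, and the two laws serve different ends. Sliding past
  \<open>F\<close> itself makes \<alpha> compatible with crossings. Sliding past a module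
  \<open>X\<close>, which is part of being an object, enters the pentagon: there a constraint on the
  last three modules has to be merged with actions that first cross the leftmost one. The axioms
  often place \<Delta> after a crossing where an action needs it before, or conversely; the
  comonadic laws of \<tau> and of the crossings translate between the two.\<close>

text \<open>
  A layer \<open>(l, (s, c, t), r)\<close> stands for the whiskered 2-cell \<open>\<iota> l \<star> c \<star> \<iota> r\<close> with \<open>c : s \<rightarrow> t\<close>, where
  composite 1-cells are written as words. A 2-cell built by \<open>\<cdot>\<close> and \<open>\<star>\<close> from given cells becomes a list of
  layers, the one applied first at the head.
\<close>

type_synonym ('m, 'c) layer = "'m list \<times> ('m list \<times> 'c \<times> 'm list) \<times> 'm list"

definition whisk :: "'m list \<Rightarrow> 'm list \<Rightarrow> ('m, 'c) layer list \<Rightarrow> ('m, 'c) layer list" where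
  [simp]: "whisk l r = map (\<lambda>(a, g, b). (l @ a, g, b @ r))"

text \<open>
  The interchange law lets a layer move ahead of an earlier one if it acts entirely to the left of it.
  Expressions that become equal after sorting all layers this way agree by interchange alone.
\<close>

fun push :: "('m, 'c) layer \<Rightarrow> ('m, 'c) layer list \<Rightarrow> ('m, 'c) layer list" where
  "push x [] = [x]"
| "push (l, (s, c, t), r) ((l', (s', c', t'), r') # d) =
     (if length l' + length s' \<le> length l
      then (l', (s', c', t'), drop (length l' + length s') l @ s @ r) #
           push (l' @ t' @ drop (length l' + length s') l, (s, c, t), r) d
      else (l, (s, c, t), r) # (l', (s', c', t'), r') # d)"

fun nf :: "('m, 'c) layer list \<Rightarrow> ('m, 'c) layer list" where
  "nf [] = []"
| "nf (x # d) = push x (nf d)"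

locale endo_cells = two_category K for K :: "('o, 'm, 'c) two_cat" (structure) +
  fixes A :: 'o
  assumes A_cell: "A \<in> Cell0 K"
begin

section \<open>Endo-1-cells of \<open>A\<close> as a strict monoidal category\<close>

abbreviation "E \<equiv> Cell1 K A A"

lemma endo_category: "category (hom_cat K A A)"
  using hom_category A_cell by blast

lemma Id2_closed: "X \<in> E \<Longrightarrow> \<iota> X \<in> Cell2 K X X"
  using category.Id_closed[OF endo_category] by (simp add: hom_cat_def)

lemma VComp_closed: "\<lbrakk>X \<in> E; Y \<in> E; Z \<in> E; g \<in> Cell2 K Y Z; f \<in> Cell2 K X Y\<rbrakk> \<Longrightarrow> g \<cdot> f \<in> Cell2 K X Z"
  using category.Comp_closed[OF endo_category] by (simp add: hom_cat_def)

lemma Id2_left: "\<lbrakk>X \<in> E; Y \<in> E; f \<in> Cell2 K X Y\<rbrakk> \<Longrightarrow> \<iota> Y \<cdot> f = f"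
  using category.Id_left[OF endo_category] by (simp add: hom_cat_def)

lemma Id2_right: "\<lbrakk>X \<in> E; Y \<in> E; f \<in> Cell2 K X Y\<rbrakk> \<Longrightarrow> f \<cdot> \<iota> X = f"
  using category.Id_right[OF endo_category] by (simp add: hom_cat_def)

lemma VComp_assoc:
  "\<lbrakk>W \<in> E; X \<in> E; Y \<in> E; Z \<in> E; h \<in> Cell2 K Y Z; g \<in> Cell2 K X Y; f \<in> Cell2 K W X\<rbrakk>
   \<Longrightarrow> (h \<cdot> g) \<cdot> f = h \<cdot> (g \<cdot> f)"
  using category.Comp_assoc[OF endo_category, of W X Y Z h g f] by (simp add: hom_cat_def)

lemmas endo_simps [simp] =
  Id1_closed[OF A_cell] Comp1_closed[OF A_cell A_cell A_cell]
  Comp1_assoc[OF A_cell A_cell A_cell A_cell]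
  Id1_left[OF A_cell A_cell] Id1_right[OF A_cell A_cell]

lemmas endo_HComp_Id2 = HComp_Id2[OF A_cell A_cell A_cell]
lemmas endo_HComp_closed = HComp_closed[OF A_cell A_cell A_cell]
lemmas endo_interchange = interchange[OF A_cell A_cell A_cell]
lemmas endo_HComp_assoc = HComp_assoc[OF A_cell A_cell A_cell A_cell]
lemmas endo_HComp_Id1_left = HComp_Id1_left[OF A_cell A_cell]
lemmas endo_HComp_Id1_right = HComp_Id1_right[OF A_cell A_cell]

definition word :: "'m list \<Rightarrow> bool" where "word w \<longleftrightarrow> set w \<subseteq> E"

definition cw :: "'m list \<Rightarrow> 'm" where "cw w = foldr (Comp1 K) w (Id1 K A)"

lemma word_simps [simp]:
  "word []" "word (X # w) \<longleftrightarrow> X \<in> E \<and> word w" "word (v @ w) \<longleftrightarrow> word v \<and> word w"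
  by (auto simp: word_def)

lemma cw_simps [simp]: "cw [] = Id1 K A" "cw (X # w) = X \<diamond> cw w"
  by (auto simp: cw_def)

lemma cw_closed [simp]: "word w \<Longrightarrow> cw w \<in> E"
  by (induction w) auto

lemma cw_append: "\<lbrakk>word v; word w\<rbrakk> \<Longrightarrow> cw (v @ w) = cw v \<diamond> cw w"
  by (induction v) auto

text \<open>Words serve as types, but only their composites matter: the same 2-cell can be typed on
  \<open>[F, F]\<close> and on \<open>[F \<diamond> F]\<close>, depending on whether a composite is
  to be taken apart or treated as one letter.\<close>

definition cell :: "'m list \<Rightarrow> 'm list \<Rightarrow> 'c \<Rightarrow> bool" where
  "cell v w c \<longleftrightarrow> word v \<and> word w \<and> c \<in> Cell2 K (cw v) (cw w)"

lemma cell_Id: "word w \<Longrightarrow> cell w w (\<iota> (cw w))"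
  by (simp add: cell_def Id2_closed)

lemma cell_VComp: "\<lbrakk>cell v w g; cell u v f\<rbrakk> \<Longrightarrow> cell u w (g \<cdot> f)"
  using VComp_closed[of "cw u" "cw v" "cw w" g f] by (simp add: cell_def)

lemma cell_HComp: "\<lbrakk>cell v v' f; cell w w' g\<rbrakk> \<Longrightarrow> cell (v @ w) (v' @ w') (f \<star> g)"
  by (auto simp: cell_def cw_append intro!: endo_HComp_closed)

lemma cell_VComp_assoc:
  "\<lbrakk>cell w z h; cell v w g; cell u v f\<rbrakk> \<Longrightarrow> (h \<cdot> g) \<cdot> f = h \<cdot> g \<cdot> f"
  unfolding cell_def by (meson VComp_assoc cw_closed)

lemma cell_HComp_assoc:
  "\<lbrakk>cell u u' h; cell v v' g; cell w w' f\<rbrakk> \<Longrightarrow> (h \<star> g) \<star> f = h \<star> g \<star> f"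
  unfolding cell_def by (meson endo_HComp_assoc cw_closed)

lemma cell_interchange:
  "\<lbrakk>cell v v' g; cell v' v'' g'; cell w w' f; cell w' w'' f'\<rbrakk>
   \<Longrightarrow> (g' \<cdot> g) \<star> (f' \<cdot> f) = (g' \<star> f') \<cdot> (g \<star> f)"
  unfolding cell_def by (meson endo_interchange cw_closed)

lemma cell_Id_left: "cell v w f \<Longrightarrow> \<iota> (cw w) \<cdot> f = f"
  unfolding cell_def by (meson Id2_left cw_closed)

lemma cell_Id_right: "cell v w f \<Longrightarrow> f \<cdot> \<iota> (cw v) = f"
  unfolding cell_def by (meson Id2_right cw_closed)

lemma HComp_Id_word: "\<lbrakk>word v; word w\<rbrakk> \<Longrightarrow> \<iota> (cw v) \<star> \<iota> (cw w) = \<iota> (cw (v @ w))"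
  by (simp add: cw_append endo_HComp_Id2)

lemma cell_unit:
  "cell v w f \<Longrightarrow> \<iota> (Id1 K A) \<star> f = f"  "cell v w f \<Longrightarrow> f \<star> \<iota> (Id1 K A) = f"
  unfolding cell_def by (meson endo_HComp_Id1_left endo_HComp_Id1_right cw_closed)+

lemma exchange:
  assumes "cell v v' f" "cell w w' g"
  shows "(f \<star> \<iota> (cw w')) \<cdot> (\<iota> (cw v) \<star> g) = f \<star> g"
    and "(\<iota> (cw v') \<star> g) \<cdot> (f \<star> \<iota> (cw w)) = f \<star> g"
proof -
  have "word v" "word v'" "word w" "word w'"
    using assms by (auto simp: cell_def)
  then have i: "cell v v (\<iota> (cw v))" "cell v' v' (\<iota> (cw v'))" "cell w w (\<iota> (cw w))" "cell w' w' (\<iota> (cw w'))"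
    by (auto intro: cell_Id)
  show "(f \<star> \<iota> (cw w')) \<cdot> (\<iota> (cw v) \<star> g) = f \<star> g"
    using cell_interchange[OF i(1) assms(1) assms(2) i(4)] assms by (simp add: cell_Id_left cell_Id_right)
  show "(\<iota> (cw v') \<star> g) \<cdot> (f \<star> \<iota> (cw w)) = f \<star> g"
    using cell_interchange[OF assms(1) i(2) i(3) assms(2)] assms by (simp add: cell_Id_left cell_Id_right)
qed

section \<open>Evaluation of layer lists and soundness of the normal form\<close>

fun layer_cell :: "('m, 'c) layer \<Rightarrow> 'c" where
  "layer_cell (l, (s, c, t), r) = \<iota> (cw l) \<star> c \<star> \<iota> (cw r)"

fun wt :: "'m list \<Rightarrow> ('m, 'c) layer list \<Rightarrow> 'm list \<Rightarrow> bool" where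
  "wt v [] w \<longleftrightarrow> word v \<and> v = w"
| "wt v ((l, (s, c, t), r) # d) w \<longleftrightarrow>
     v = l @ s @ r \<and> word l \<and> word r \<and> cell s t c \<and> wt (l @ t @ r) d w"

fun ev :: "'m list \<Rightarrow> ('m, 'c) layer list \<Rightarrow> 'c" where
  "ev v [] = \<iota> (cw v)"
| "ev v ((l, (s, c, t), r) # d) = ev (l @ t @ r) d \<cdot> layer_cell (l, (s, c, t), r)"

lemma layer_cell: "\<lbrakk>word l; word r; cell s t c\<rbrakk> \<Longrightarrow> cell (l @ s @ r) (l @ t @ r) (layer_cell (l, (s, c, t), r))"
  by (auto intro!: cell_HComp cell_Id)

lemma wt_cell: "wt v d w \<Longrightarrow> cell v w (ev v d)"
proof (induction v d w rule: wt.induct)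
  case (1 v w) then show ?case by (auto intro: cell_Id)
next
  case (2 v l s c t r d w)
  then show ?case using layer_cell[of l r s t c] cell_VComp by fastforce
qed

lemma wt_append: "\<lbrakk>wt u d v; wt v e w\<rbrakk> \<Longrightarrow> wt u (d @ e) w"
  by (induction u d v rule: wt.induct) auto

lemma ev_append: "\<lbrakk>wt u d v; wt v e w\<rbrakk> \<Longrightarrow> ev u (d @ e) = ev v e \<cdot> ev u d"
proof (induction u d v rule: wt.induct)
  case (1 v u) then show ?case using cell_Id_right[OF wt_cell[of v e w]] by simp
next
  case (2 v l s c t r d w')
  note lc = layer_cell[of l r s t c]
  then show ?case
    using 2 cell_VComp_assoc[OF wt_cell[of w' e w] wt_cell[of "l @ t @ r" d w'] lc]
    by simp
qed

lemma wt_whisk: "\<lbrakk>wt v d w; word l; word r\<rbrakk> \<Longrightarrow> wt (l @ v @ r) (whisk l r d) (l @ w @ r)"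
  by (induction v d w rule: wt.induct) (auto simp: whisk_def)

lemma ev_whisk: "\<lbrakk>wt v d w; word l; word r\<rbrakk> \<Longrightarrow> ev (l @ v @ r) (whisk l r d) = \<iota> (cw l) \<star> ev v d \<star> \<iota> (cw r)"
proof (induction v d w rule: wt.induct)
  case (1 v w) then show ?case by (auto simp: whisk_def simp flip: HComp_Id_word)
next
  case (2 v a s c t b d w)
  have *: "word a" "word b" "cell s t c" "wt (a @ t @ b) d w" using 2 by auto
  have ws: "cell s t c" "word s" "word t" using * by (auto simp: cell_def)
  note i = cell_Id[OF \<open>word l\<close>] cell_Id[OF \<open>word r\<close>] cell_Id[OF \<open>word a\<close>] cell_Id[OF \<open>word b\<close>]
  have lc: "layer_cell (l @ a, (s, c, t), b @ r) = \<iota> (cw l) \<star> layer_cell (a, (s, c, t), b) \<star> \<iota> (cw r)"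
    using * 2 i ws
      cell_HComp_assoc[OF i(1) i(3) cell_HComp[OF ws(1) cell_HComp[OF i(4) i(2)]]]
      cell_HComp_assoc[OF i(3) cell_HComp[OF ws(1) i(4)] i(2)]
      cell_HComp_assoc[OF ws(1) i(4) i(2)]
    by (simp flip: HComp_Id_word)
  note c1 = layer_cell[OF *(1-3)] and c2 = wt_cell[OF *(4)]
  have ii: "\<iota> (cw x) \<cdot> \<iota> (cw x) = \<iota> (cw x)" if "word x" for x
    using cell_Id_left[OF cell_Id[OF that]] .
  have "\<iota> (cw l) \<star> (ev (a @ t @ b) d \<cdot> layer_cell (a, (s, c, t), b)) \<star> \<iota> (cw r) =
     (\<iota> (cw l) \<cdot> \<iota> (cw l)) \<star> ((ev (a @ t @ b) d \<star> \<iota> (cw r)) \<cdot> (layer_cell (a, (s, c, t), b) \<star> \<iota> (cw r)))"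
    using cell_interchange[OF c1 c2 i(2) i(2)] ii 2 by simp
  also have "\<dots> = (\<iota> (cw l) \<star> ev (a @ t @ b) d \<star> \<iota> (cw r)) \<cdot> (\<iota> (cw l) \<star> layer_cell (a, (s, c, t), b) \<star> \<iota> (cw r))"
    by (rule cell_interchange[OF i(1) i(1) cell_HComp[OF c1 i(2)] cell_HComp[OF c2 i(2)]])
  finally have "\<iota> (cw l) \<star> ev v ((a, (s, c, t), b) # d) \<star> \<iota> (cw r) =
    (\<iota> (cw l) \<star> ev (a @ t @ b) d \<star> \<iota> (cw r)) \<cdot> layer_cell (l @ a, (s, c, t), b @ r)"
    unfolding lc by simp
  then show ?case using 2 by (simp add: whisk_def)
qed

text \<open>The one rewriting move behind \<open>push\<close>: \<open>c\<close> and
  \<open>c'\<close> act on disjoint subwords with the gap \<open>m\<close> between them, so either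
  may come first.\<close>

lemma swap:
  assumes "word l" "word m" "word r" "cell s t c" "cell s' t' c'"
  shows "layer_cell (l @ t @ m, (s', c', t'), r) \<cdot> layer_cell (l, (s, c, t), m @ s' @ r) =
         layer_cell (l, (s, c, t), m @ t' @ r) \<cdot> layer_cell (l @ s @ m, (s', c', t'), r)"
proof -
  note i = cell_Id[OF assms(1)] cell_Id[OF assms(2)] cell_Id[OF assms(3)]
  have w: "word s" "word t" "word s'" "word t'" using assms by (auto simp: cell_def)
  let ?f = "\<iota> (cw l) \<star> c" and ?g = "\<iota> (cw m) \<star> c' \<star> \<iota> (cw r)"
  have f: "cell (l @ s) (l @ t) ?f" and g: "cell (m @ s' @ r) (m @ t' @ r) ?g"
    using assms by (auto intro!: cell_HComp cell_Id)
  have *: "layer_cell (l, (s, c, t), x) = ?f \<star> \<iota> (cw x)" if "word x" for x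
    using cell_HComp_assoc[OF i(1) assms(4) cell_Id[OF that]] by simp
  have **: "layer_cell (x @ m, (s', c', t'), r) = \<iota> (cw x) \<star> ?g" if "word x" for x
    using cell_HComp_assoc[OF cell_Id[OF that] i(2) cell_HComp[OF assms(5) i(3)]] that assms
    by (simp flip: HComp_Id_word)
  show ?thesis
    using *[of "m @ s' @ r"] *[of "m @ t' @ r"] **[of "l @ s"] **[of "l @ t"] exchange[OF f g] w assms
    by (simp del: layer_cell.simps)
qed

lemma push:
  "\<lbrakk>wt v (x # d) w\<rbrakk> \<Longrightarrow> wt v (push x d) w \<and> ev v (push x d) = ev v (x # d)"
proof (induction x d arbitrary: v rule: push.induct)
  case (1 x) then show ?case by simp
next
  case (2 l s c t r l' s' c' t' r' d)
  show ?case
  proof (cases "length l' + length s' \<le> length l")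
    case True
    define m where "m = drop (length l' + length s') l"
    from 2 have eq: "l @ t @ r = l' @ s' @ r'" and wc: "word l" "word r" "word l'" "word r'" "cell s t c" "cell s' t' c'"
      "wt (l' @ t' @ r') d w" "v = l @ s @ r" by auto
    \<comment> \<open>Typing gives two factorizations of the intermediate word. Cutting both behind
      the source of the second layer shows that this source lies inside \<open>l\<close>, with
      \<open>m\<close> as the remaining gap.\<close>
    have "take (length l' + length s') (l @ t @ r) = take (length l' + length s') (l' @ s' @ r')"
      using eq by simp
    then have "take (length l' + length s') l = l' @ s'" using True by simp
    then have l: "l = l' @ s' @ m" unfolding m_def by (metis append.assoc append_take_drop_id)
    then have r': "r' = m @ t @ r" using eq by simp
    have wm: "word m" using wc l by simp
    have ws: "word s" "word t" "word s'" "word t'" using wc by (auto simp: cell_def)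
    let ?x = "(l' @ t' @ m, (s, c, t), r)"
    have "wt (l' @ t' @ m @ s @ r) (?x # d) w" using wc l r' ws by simp
    with 2(1)[OF True] have IH: "wt (l' @ t' @ m @ s @ r) (push ?x d) w"
      "ev (l' @ t' @ m @ s @ r) (push ?x d) = ev (l' @ t' @ m @ s @ r) (?x # d)"
      unfolding m_def[symmetric] by auto
    have p: "push (l, (s, c, t), r) ((l', (s', c', t'), r') # d) = (l', (s', c', t'), m @ s @ r) # push ?x d"
      using True by (simp add: m_def)
    note a = wt_cell[OF wc(7)]
    have b: "cell (l' @ t' @ m @ s @ r) (l' @ t' @ r') (layer_cell (l' @ t' @ m, (s, c, t), r))"
      using layer_cell[of "l' @ t' @ m" r s t c] wc wm ws r' by simp
    have b': "cell (l' @ s' @ m @ s @ r) (l' @ t' @ m @ s @ r) (layer_cell (l', (s', c', t'), m @ s @ r))"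
      using layer_cell[of l' "m @ s @ r" s' t' c'] wc wm ws r' by simp
    have e: "cell (l' @ s' @ m @ s @ r) (l' @ s' @ r') (layer_cell (l' @ s' @ m, (s, c, t), r))"
      using layer_cell[of "l' @ s' @ m" r s t c] wc wm ws r' by simp
    have e': "cell (l' @ s' @ r') (l' @ t' @ r') (layer_cell (l', (s', c', t'), r'))"
      using layer_cell[of l' r' s' t' c'] wc wm ws r' by simp
    have "ev v (push (l, (s, c, t), r) ((l', (s', c', t'), r') # d)) =
      (ev (l' @ t' @ r') d \<cdot> layer_cell (l' @ t' @ m, (s, c, t), r)) \<cdot> layer_cell (l', (s', c', t'), m @ s @ r)"
      unfolding p using IH(2) r' by (simp del: layer_cell.simps)
    also have "\<dots> = ev (l' @ t' @ r') d \<cdot> layer_cell (l', (s', c', t'), r') \<cdot> layer_cell (l' @ s' @ m, (s, c, t), r)"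
      unfolding cell_VComp_assoc[OF a b b'] using swap[OF wc(3) wm wc(2) wc(6) wc(5)] r' by simp
    also have "\<dots> = ev v ((l, (s, c, t), r) # (l', (s', c', t'), r') # d)"
      using cell_VComp_assoc[OF a e' e] l r' by simp
    finally show ?thesis using p IH(1) wc l wm ws by simp
  next
    case False
    then show ?thesis using 2 by auto
  qed
qed

text \<open>Soundness is all that is needed: equal normal forms serve as a sufficient criterion for
  equality of 2-cells.\<close>

lemma nf: "wt v d w \<Longrightarrow> wt v (nf d) w \<and> ev v (nf d) = ev v d"
proof (induction v d w rule: wt.induct)
  case (1 v w) then show ?case by auto
next
  case (2 v l s c t r d w)
  then have "wt v ((l, (s, c, t), r) # nf d) w" by simp
  from push[OF this] 2 show ?case by simp
qed

section \<open>Reading off layer lists from 2-cells\<close>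

definition rep :: "'m list \<Rightarrow> 'm list \<Rightarrow> 'c \<Rightarrow> ('m, 'c) layer list \<Rightarrow> bool" where
  "rep v w c d \<longleftrightarrow> wt v d w \<and> ev v d = c"

lemma rep_cell: "cell v w c \<Longrightarrow> rep v w c [([], (v, c, w), [])]"
  using cell_Id_left[of v w c] cell_unit[of v w c]
  by (simp add: rep_def) (simp add: cell_def)

text \<open>The two middle words are found independently, as unevaluated concatenations; keeping
  \<open>v = v'\<close> as a separate premise leaves their comparison to the simplifier.\<close>

lemma rep_VComp:
  "\<lbrakk>rep u v f d; rep v' w g e; v = v'\<rbrakk> \<Longrightarrow> rep u w (g \<cdot> f) (d @ e)"
  by (auto simp: rep_def wt_append ev_append)

text \<open>A horizontal composite is serialized by letting the left factor act first, on
  \<open>w\<close> as a spectator, and then the right factor beside the new word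
  \<open>v'\<close>.\<close>

lemma rep_HComp:
  assumes "rep v v' f d" "rep w w' g e"
  shows "rep (v @ w) (v' @ w') (f \<star> g) (whisk [] w d @ whisk v' [] e)"
proof -
  have wd: "word v" "word v'" "word w" "word w'" and c: "cell v v' f" "cell w w' g"
    using assms wt_cell[of v d v'] wt_cell[of w e w'] by (auto simp: rep_def cell_def)
  have 1: "wt (v @ w) (whisk [] w d) (v' @ w)" "wt (v' @ w) (whisk v' [] e) (v' @ w')"
    using wt_whisk[of v d v' "[]" w] wt_whisk[of w e w' v' "[]"] assms wd by (auto simp: rep_def)
  have 2: "ev (v @ w) (whisk [] w d) = f \<star> \<iota> (cw w)" "ev (v' @ w) (whisk v' [] e) = \<iota> (cw v') \<star> g"
    using ev_whisk[of v d v' "[]" w] ev_whisk[of w e w' v' "[]"] assms wd c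
      cell_unit(1)[OF cell_HComp[OF c(1) cell_Id[OF wd(3)]]]
      cell_unit(2)[OF c(2)] by (auto simp: rep_def)
  show ?thesis
    unfolding rep_def using wt_append[OF 1] ev_append[OF 1] 2 exchange(2)[OF c] by simp
qed

lemma rep_Id: "X \<in> E \<Longrightarrow> rep [X] [X] (\<iota> X) []"
  by (simp add: rep_def)

lemma rep_Id1: "rep [] [] (\<iota> (Id1 K A)) []"
  by (simp add: rep_def)

lemma rep_Id_Comp: "\<lbrakk>rep v v' (\<iota> X) []; rep w w' (\<iota> Y) []; X \<in> E; Y \<in> E\<rbrakk> \<Longrightarrow> rep (v @ w) (v' @ w') (\<iota> (X \<diamond> Y)) []"
  using rep_HComp[of v v' "\<iota> X" "[]" w w' "\<iota> Y" "[]"] by (simp add: endo_HComp_Id2 whisk_def)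

lemma cellI:
  "\<lbrakk>rep v w c d; word v'; word w'; cw v = cw v'; cw w = cw w'\<rbrakk> \<Longrightarrow> cell v' w' c"
  using wt_cell[of v d w] by (simp add: rep_def cell_def)

lemma diagram_eqI:
  "\<lbrakk>rep v w f d; rep v' w' g e; v = v'; nf d = nf e\<rbrakk> \<Longrightarrow> f = g"
  unfolding rep_def using nf by metis

text \<open>Tried in this order: \<open>rep_Id_Comp\<close> has to come before \<open>rep_Id\<close>, which would treat a composite 1-cell as
  a single letter, and \<open>rep_cell\<close> matches every 2-cell.\<close>

lemmas rep_intros = rep_VComp rep_HComp rep_Id1 rep_Id_Comp rep_Id rep_cell

section \<open>Actions and crossings on composites\<close>

text \<open>
  An action \<open>\<nu>\<close> of \<open>F\<close> on \<open>X\<close> and an action \<open>\<phi>\<close> of \<open>G\<close> on \<open>P\<close> combine, along a crossing \<open>s : GX \<rightarrow> XG\<close>, to an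
  action of \<open>FG\<close> on \<open>XP\<close>.
\<close>

definition smash :: "'m \<Rightarrow> 'c \<Rightarrow> 'c \<Rightarrow> 'c \<Rightarrow> 'm \<Rightarrow> 'c" where
  "smash F \<nu> s \<phi> P = (\<nu> \<star> \<phi>) \<cdot> (\<iota> F \<star> s \<star> \<iota> P)"

context
  fixes F G X P :: 'm and \<nu> s \<phi> :: 'c
  assumes cells1 [simp]: "F \<in> E" "G \<in> E" "X \<in> E" "P \<in> E"
    and \<nu>: "cell [F, X] [X] \<nu>" and \<phi>: "cell [G, P] [P] \<phi>" and s: "cell [G, X] [X, G] s"
begin

text \<open>
  The 2-cell \<open>\<omega>\<close> on the target allows \<open>m\<close> to differ from the multiplication of \<open>G\<close>; for the pentagon,
  \<open>\<omega>\<close> is an associativity constraint.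
\<close>

lemma smash_assoc:
  assumes "cell [F, F] [F] \<mu>" "cell [G, G] [G] m" "cell [G, F] [F, G] t" "cell [P] [P] \<omega>"
    and \<nu>_assoc: "\<nu> \<cdot> (\<mu> \<star> \<iota> X) = \<nu> \<cdot> (\<iota> F \<star> \<nu>)"
    and s_\<nu>: "s \<cdot> (\<iota> G \<star> \<nu>) = (\<nu> \<star> \<iota> G) \<cdot> (\<iota> F \<star> s) \<cdot> (t \<star> \<iota> X)"
    and s_m: "s \<cdot> (m \<star> \<iota> X) = (\<iota> X \<star> m) \<cdot> (s \<star> \<iota> G) \<cdot> (\<iota> G \<star> s)"
    and \<phi>_assoc: "\<omega> \<cdot> \<phi> \<cdot> (\<iota> G \<star> \<phi>) = \<phi> \<cdot> (m \<star> \<iota> P)"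
  shows "(\<iota> X \<star> \<omega>) \<cdot> smash F \<nu> s \<phi> P \<cdot> (\<iota> (F \<diamond> G) \<star> smash F \<nu> s \<phi> P) =
         smash F \<nu> s \<phi> P \<cdot> (((\<mu> \<star> m) \<cdot> (\<iota> F \<star> t \<star> \<iota> G)) \<star> \<iota> (X \<diamond> P))"
proof -
  note cells = \<nu> \<phi> s assms(1-4)
  have "(\<iota> X \<star> \<omega>) \<cdot> smash F \<nu> s \<phi> P \<cdot> (\<iota> (F \<diamond> G) \<star> smash F \<nu> s \<phi> P) =
     (\<nu> \<star> (\<omega> \<cdot> \<phi>)) \<cdot> (\<iota> F \<star> (s \<cdot> (\<iota> G \<star> \<nu>)) \<star> \<phi>) \<cdot> (\<iota> F \<star> \<iota> G \<star> \<iota> F \<star> s \<star> \<iota> P)"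
    unfolding smash_def
    by (rule diagram_eqI, (rule rep_intros cells | simp)+)
  \<comment> \<open>Once the inner \<nu> has been pulled through the crossing of \<open>G\<close>,
    both \<nu> meet on \<open>X\<close> and both \<phi> meet on \<open>P\<close>, so the two
    associativity laws apply separately.\<close>
  also have "\<dots> = ((\<nu> \<cdot> (\<iota> F \<star> \<nu>)) \<star> (\<omega> \<cdot> \<phi> \<cdot> (\<iota> G \<star> \<phi>))) \<cdot> (\<iota> F \<star> \<iota> F \<star> s \<star> \<iota> G \<star> \<iota> P) \<cdot> (\<iota> F \<star> t \<star> s \<star> \<iota> P)"
    unfolding s_\<nu>
    by (rule diagram_eqI, (rule rep_intros cells | simp)+)
  also have "\<dots> = (\<nu> \<star> \<phi>) \<cdot> (\<mu> \<star> ((\<iota> X \<star> m) \<cdot> (s \<star> \<iota> G) \<cdot> (\<iota> G \<star> s)) \<star> \<iota> P) \<cdot> (\<iota> F \<star> t \<star> \<iota> G \<star> \<iota> X \<star> \<iota> P)"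
    unfolding \<nu>_assoc[symmetric] \<phi>_assoc
    by (rule diagram_eqI, (rule rep_intros cells | simp)+)
  also have "\<dots> = smash F \<nu> s \<phi> P \<cdot> (((\<mu> \<star> m) \<cdot> (\<iota> F \<star> t \<star> \<iota> G)) \<star> \<iota> (X \<diamond> P))"
    unfolding s_m[symmetric] smash_def
    by (rule diagram_eqI, (rule rep_intros cells | simp)+)
  finally show ?thesis .
qed

lemma cell_smash: "cell [F, G, X, P] [X, P] (smash F \<nu> s \<phi> P)"
  unfolding smash_def by (rule cellI, (rule rep_intros \<nu> \<phi> s | simp)+)

text \<open>The case of \<open>smash_assoc\<close> in which \<omega> is the identity of
  \<open>P\<close>; what is left is to remove that identity.\<close>

lemma smash_mult:
  assumes "cell [F, F] [F] \<mu>" "cell [G, G] [G] m" "cell [G, F] [F, G] t"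
    and "\<nu> \<cdot> (\<mu> \<star> \<iota> X) = \<nu> \<cdot> (\<iota> F \<star> \<nu>)"
    and "s \<cdot> (\<iota> G \<star> \<nu>) = (\<nu> \<star> \<iota> G) \<cdot> (\<iota> F \<star> s) \<cdot> (t \<star> \<iota> X)"
    and "s \<cdot> (m \<star> \<iota> X) = (\<iota> X \<star> m) \<cdot> (s \<star> \<iota> G) \<cdot> (\<iota> G \<star> s)"
    and \<phi>_assoc: "\<phi> \<cdot> (\<iota> G \<star> \<phi>) = \<phi> \<cdot> (m \<star> \<iota> P)"
  shows "smash F \<nu> s \<phi> P \<cdot> (\<iota> (F \<diamond> G) \<star> smash F \<nu> s \<phi> P) =
         smash F \<nu> s \<phi> P \<cdot> (((\<mu> \<star> m) \<cdot> (\<iota> F \<star> t \<star> \<iota> G)) \<star> \<iota> (X \<diamond> P))"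
proof -
  have i: "cell [P] [P] (\<iota> P)" using cell_Id[of "[P]"] by simp
  have "\<iota> P \<cdot> \<phi> = \<phi>" using cell_Id_left[OF \<phi>] by simp
  moreover have "cell [G, G, P] [G, P] (\<iota> G \<star> \<phi>)"
    by (rule cellI, (rule rep_intros \<phi> | simp)+)
  ultimately have "\<iota> P \<cdot> \<phi> \<cdot> (\<iota> G \<star> \<phi>) = \<phi> \<cdot> (m \<star> \<iota> P)"
    using cell_VComp_assoc[OF i \<phi>, of "[G, G, P]" "\<iota> G \<star> \<phi>"] \<phi>_assoc by simp
  from smash_assoc[OF assms(1-3) i assms(4-6) this]
  have "(\<iota> X \<star> \<iota> P) \<cdot> smash F \<nu> s \<phi> P \<cdot> (\<iota> (F \<diamond> G) \<star> smash F \<nu> s \<phi> P) =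
         smash F \<nu> s \<phi> P \<cdot> (((\<mu> \<star> m) \<cdot> (\<iota> F \<star> t \<star> \<iota> G)) \<star> \<iota> (X \<diamond> P))" .
  moreover have "(\<iota> X \<star> \<iota> P) \<cdot> smash F \<nu> s \<phi> P \<cdot> (\<iota> (F \<diamond> G) \<star> smash F \<nu> s \<phi> P) =
      smash F \<nu> s \<phi> P \<cdot> (\<iota> (F \<diamond> G) \<star> smash F \<nu> s \<phi> P)"
    by (rule diagram_eqI, (rule rep_intros cell_smash | simp)+)
  ultimately show ?thesis by simp
qed

lemma smash_unit:
  assumes "cell [] [F] \<eta>" "cell [] [G] e"
    and \<nu>_unit: "\<nu> \<cdot> (\<eta> \<star> \<iota> X) = \<iota> X"
    and s_e: "s \<cdot> (e \<star> \<iota> X) = \<iota> X \<star> e"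
    and \<phi>_unit: "\<phi> \<cdot> (e \<star> \<iota> P) = \<iota> P"
  shows "smash F \<nu> s \<phi> P \<cdot> ((\<eta> \<star> e) \<star> \<iota> (X \<diamond> P)) = \<iota> (X \<diamond> P)"
proof -
  note cells = \<nu> \<phi> s assms(1,2)
  have "smash F \<nu> s \<phi> P \<cdot> ((\<eta> \<star> e) \<star> \<iota> (X \<diamond> P)) = (\<nu> \<star> \<phi>) \<cdot> (\<eta> \<star> (s \<cdot> (e \<star> \<iota> X)) \<star> \<iota> P)"
    unfolding smash_def
    by (rule diagram_eqI, (rule rep_intros cells | simp)+)
  also have "\<dots> = (\<nu> \<cdot> (\<eta> \<star> \<iota> X)) \<star> (\<phi> \<cdot> (e \<star> \<iota> P))"
    unfolding s_e
    by (rule diagram_eqI, (rule rep_intros cells | simp)+)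
  finally show ?thesis
    unfolding \<nu>_unit \<phi>_unit by (simp add: endo_HComp_Id2)
qed

text \<open>An outer strand \<open>F\<close> slides past both actions, and the Yang-Baxter
  hypothesis \<open>yb\<close> takes it past the crossing \<open>s\<close> between them. It thereby
  crosses \<open>F\<close> by \<tau> and then \<open>G\<close> by \<open>u\<close>, which is the
  crossing past \<open>FG\<close> in the conclusion.\<close>

lemma smash_cross:
  assumes "cell [F, F] [F, F] \<tau>" "cell [F, G] [G, F] u" "cell [F, X] [X, F] \<sigma>" "cell [F, P] [P, F] \<rho>"
    and \<sigma>_\<nu>: "\<sigma> \<cdot> (\<iota> F \<star> \<nu>) = (\<nu> \<star> \<iota> F) \<cdot> (\<iota> F \<star> \<sigma>) \<cdot> (\<tau> \<star> \<iota> X)"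
    and \<rho>_\<phi>: "\<rho> \<cdot> (\<iota> F \<star> \<phi>) = (\<phi> \<star> \<iota> F) \<cdot> (\<iota> G \<star> \<rho>) \<cdot> (u \<star> \<iota> P)"
    and yb: "(\<iota> X \<star> u) \<cdot> (\<sigma> \<star> \<iota> G) \<cdot> (\<iota> F \<star> s) = (s \<star> \<iota> F) \<cdot> (\<iota> G \<star> \<sigma>) \<cdot> (u \<star> \<iota> X)"
  shows "((\<iota> X \<star> \<rho>) \<cdot> (\<sigma> \<star> \<iota> P)) \<cdot> (\<iota> F \<star> smash F \<nu> s \<phi> P) =
    (smash F \<nu> s \<phi> P \<star> \<iota> F) \<cdot> (\<iota> (F \<diamond> G) \<star> ((\<iota> X \<star> \<rho>) \<cdot> (\<sigma> \<star> \<iota> P))) \<cdot>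
    (((\<iota> F \<star> u) \<cdot> (\<tau> \<star> \<iota> G)) \<star> \<iota> (X \<diamond> P))"
proof -
  note cells = \<nu> \<phi> s assms(1-4)
  have "((\<iota> X \<star> \<rho>) \<cdot> (\<sigma> \<star> \<iota> P)) \<cdot> (\<iota> F \<star> smash F \<nu> s \<phi> P) =
    (\<iota> X \<star> (\<rho> \<cdot> (\<iota> F \<star> \<phi>))) \<cdot> ((\<sigma> \<cdot> (\<iota> F \<star> \<nu>)) \<star> \<iota> G \<star> \<iota> P) \<cdot> (\<iota> F \<star> \<iota> F \<star> s \<star> \<iota> P)"
    unfolding smash_def
    by (rule diagram_eqI, (rule rep_intros cells | simp)+)
  also have "\<dots> = (\<nu> \<star> \<phi> \<star> \<iota> F) \<cdot> (\<iota> F \<star> \<iota> X \<star> \<iota> G \<star> \<rho>) \<cdot>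
      (\<iota> F \<star> ((\<iota> X \<star> u) \<cdot> (\<sigma> \<star> \<iota> G) \<cdot> (\<iota> F \<star> s)) \<star> \<iota> P) \<cdot> (\<tau> \<star> \<iota> G \<star> \<iota> X \<star> \<iota> P)"
    unfolding \<sigma>_\<nu> \<rho>_\<phi>
    by (rule diagram_eqI, (rule rep_intros cells | simp)+)
  also have "\<dots> = (smash F \<nu> s \<phi> P \<star> \<iota> F) \<cdot> (\<iota> (F \<diamond> G) \<star> ((\<iota> X \<star> \<rho>) \<cdot> (\<sigma> \<star> \<iota> P))) \<cdot>
    (((\<iota> F \<star> u) \<cdot> (\<tau> \<star> \<iota> G)) \<star> \<iota> (X \<diamond> P))"
    unfolding yb smash_def
    by (rule diagram_eqI, (rule rep_intros cells | simp)+)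
  finally show ?thesis .
qed

lemma smash_natural:
  assumes [simp]: "X' \<in> E" "P' \<in> E"
    and cells': "cell [F, X'] [X'] \<nu>'" "cell [G, P'] [P'] \<phi>'" "cell [G, X'] [X', G] s'"
      "cell [X] [X'] f" "cell [P] [P'] g"
    and f_\<nu>: "f \<cdot> \<nu> = \<nu>' \<cdot> (\<iota> F \<star> f)"
    and f_s: "(f \<star> \<iota> G) \<cdot> s = s' \<cdot> (\<iota> G \<star> f)"
    and g_\<phi>: "g \<cdot> \<phi> = \<phi>' \<cdot> (\<iota> G \<star> g)"
  shows "(f \<star> g) \<cdot> smash F \<nu> s \<phi> P = smash F \<nu>' s' \<phi>' P' \<cdot> (\<iota> (F \<diamond> G) \<star> f \<star> g)"
proof -
  note cells = \<nu> \<phi> s cells'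
  have "(f \<star> g) \<cdot> smash F \<nu> s \<phi> P = ((f \<cdot> \<nu>) \<star> (g \<cdot> \<phi>)) \<cdot> (\<iota> F \<star> s \<star> \<iota> P)"
    unfolding smash_def
    by (rule diagram_eqI, (rule rep_intros cells | simp)+)
  also have "\<dots> = (\<nu>' \<star> \<phi>') \<cdot> (\<iota> F \<star> ((f \<star> \<iota> G) \<cdot> s) \<star> g)"
    unfolding f_\<nu> g_\<phi>
    by (rule diagram_eqI, (rule rep_intros cells | simp)+)
  also have "\<dots> = smash F \<nu>' s' \<phi>' P' \<cdot> (\<iota> (F \<diamond> G) \<star> f \<star> g)"
    unfolding f_s smash_def
    by (rule diagram_eqI, (rule rep_intros cells | simp)+)
  finally show ?thesis .
qed

end

section \<open>Crossing a composite \<open>FG\<close> past one 1-cell\<close>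

context
  fixes F G X :: 'm and \<sigma> s :: 'c
  assumes cells1 [simp]: "F \<in> E" "G \<in> E" "X \<in> E"
    and \<sigma>: "cell [F, X] [X, F] \<sigma>" and s: "cell [G, X] [X, G] s"
begin

text \<open>The factors \<open>F\<close> and \<open>G\<close> are multiplied on either side of
  \<open>X\<close> by \<open>\<sigma>_\<mu>\<close> and \<open>s_m\<close>; the crossing
  \<open>t\<close> that interleaves them is carried past \<open>X\<close> by
  \<open>yb\<close>.\<close>

lemma cross_mult:
  assumes "cell [F, F] [F] \<mu>" "cell [G, G] [G] m" "cell [G, F] [F, G] t"
    and \<sigma>_\<mu>: "\<sigma> \<cdot> (\<mu> \<star> \<iota> X) = (\<iota> X \<star> \<mu>) \<cdot> (\<sigma> \<star> \<iota> F) \<cdot> (\<iota> F \<star> \<sigma>)"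
    and s_m: "s \<cdot> (m \<star> \<iota> X) = (\<iota> X \<star> m) \<cdot> (s \<star> \<iota> G) \<cdot> (\<iota> G \<star> s)"
    and yb: "(\<iota> X \<star> t) \<cdot> (s \<star> \<iota> F) \<cdot> (\<iota> G \<star> \<sigma>) = (\<sigma> \<star> \<iota> G) \<cdot> (\<iota> F \<star> s) \<cdot> (t \<star> \<iota> X)"
  shows "((\<sigma> \<star> \<iota> G) \<cdot> (\<iota> F \<star> s)) \<cdot> (((\<mu> \<star> m) \<cdot> (\<iota> F \<star> t \<star> \<iota> G)) \<star> \<iota> X) =
    (\<iota> X \<star> ((\<mu> \<star> m) \<cdot> (\<iota> F \<star> t \<star> \<iota> G))) \<cdot> (((\<sigma> \<star> \<iota> G) \<cdot> (\<iota> F \<star> s)) \<star> \<iota> (F \<diamond> G)) \<cdot>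
    (\<iota> (F \<diamond> G) \<star> ((\<sigma> \<star> \<iota> G) \<cdot> (\<iota> F \<star> s)))"
proof -
  note cells = \<sigma> s assms(1-3)
  have "((\<sigma> \<star> \<iota> G) \<cdot> (\<iota> F \<star> s)) \<cdot> (((\<mu> \<star> m) \<cdot> (\<iota> F \<star> t \<star> \<iota> G)) \<star> \<iota> X) =
    ((\<sigma> \<cdot> (\<mu> \<star> \<iota> X)) \<star> \<iota> G) \<cdot> (\<iota> F \<star> \<iota> F \<star> (s \<cdot> (m \<star> \<iota> X))) \<cdot> (\<iota> F \<star> t \<star> \<iota> G \<star> \<iota> X)"
    by (rule diagram_eqI, (rule rep_intros cells | simp)+)
  also have "\<dots> = (\<iota> X \<star> \<mu> \<star> m) \<cdot> (\<sigma> \<star> \<iota> F \<star> \<iota> G \<star> \<iota> G) \<cdot>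
      (\<iota> F \<star> ((\<sigma> \<star> \<iota> G) \<cdot> (\<iota> F \<star> s) \<cdot> (t \<star> \<iota> X)) \<star> \<iota> G) \<cdot> (\<iota> F \<star> \<iota> G \<star> \<iota> F \<star> s)"
    unfolding \<sigma>_\<mu> s_m
    by (rule diagram_eqI, (rule rep_intros cells | simp)+)
  also have "\<dots> = (\<iota> X \<star> ((\<mu> \<star> m) \<cdot> (\<iota> F \<star> t \<star> \<iota> G))) \<cdot> (((\<sigma> \<star> \<iota> G) \<cdot> (\<iota> F \<star> s)) \<star> \<iota> (F \<diamond> G)) \<cdot>
    (\<iota> (F \<diamond> G) \<star> ((\<sigma> \<star> \<iota> G) \<cdot> (\<iota> F \<star> s)))"
    unfolding yb[symmetric]
    by (rule diagram_eqI, (rule rep_intros cells | simp)+)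
  finally show ?thesis .
qed

lemma cross_action:
  assumes "cell [F, F] [F, F] \<tau>" "cell [G, F] [F, G] t" "cell [F, X] [X] \<nu>"
    and \<sigma>_\<nu>: "\<sigma> \<cdot> (\<iota> F \<star> \<nu>) = (\<nu> \<star> \<iota> F) \<cdot> (\<iota> F \<star> \<sigma>) \<cdot> (\<tau> \<star> \<iota> X)"
    and s_\<nu>: "s \<cdot> (\<iota> G \<star> \<nu>) = (\<nu> \<star> \<iota> G) \<cdot> (\<iota> F \<star> s) \<cdot> (t \<star> \<iota> X)"
  shows "((\<sigma> \<star> \<iota> G) \<cdot> (\<iota> F \<star> s)) \<cdot> (\<iota> (F \<diamond> G) \<star> \<nu>) =
    (\<nu> \<star> \<iota> (F \<diamond> G)) \<cdot> (\<iota> F \<star> ((\<sigma> \<star> \<iota> G) \<cdot> (\<iota> F \<star> s))) \<cdot> (((\<tau> \<star> \<iota> G) \<cdot> (\<iota> F \<star> t)) \<star> \<iota> X)"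
proof -
  note cells = \<sigma> s assms(1-3)
  have "((\<sigma> \<star> \<iota> G) \<cdot> (\<iota> F \<star> s)) \<cdot> (\<iota> (F \<diamond> G) \<star> \<nu>) = (\<sigma> \<star> \<iota> G) \<cdot> (\<iota> F \<star> (s \<cdot> (\<iota> G \<star> \<nu>)))"
    by (rule diagram_eqI, (rule rep_intros cells | simp)+)
  also have "\<dots> = ((\<sigma> \<cdot> (\<iota> F \<star> \<nu>)) \<star> \<iota> G) \<cdot> (\<iota> F \<star> \<iota> F \<star> s) \<cdot> (\<iota> F \<star> t \<star> \<iota> X)"
    unfolding s_\<nu>
    by (rule diagram_eqI, (rule rep_intros cells | simp)+)
  also have "\<dots> = (\<nu> \<star> \<iota> (F \<diamond> G)) \<cdot> (\<iota> F \<star> ((\<sigma> \<star> \<iota> G) \<cdot> (\<iota> F \<star> s))) \<cdot> (((\<tau> \<star> \<iota> G) \<cdot> (\<iota> F \<star> t)) \<star> \<iota> X)"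
    unfolding \<sigma>_\<nu>
    by (rule diagram_eqI, (rule rep_intros cells | simp)+)
  finally show ?thesis .
qed

text \<open>The conclusion is \<open>yb_t\<close> again, with \<open>FG\<close> for
  \<open>G\<close>. It supplies the hypothesis \<open>yb\<close> of \<open>cross_mult\<close> when
  one more strand is added.\<close>

lemma cross_braid_right:
  assumes "cell [F, F] [F, F] \<tau>" "cell [G, F] [F, G] t"
    and yb: "(\<iota> X \<star> \<tau>) \<cdot> (\<sigma> \<star> \<iota> F) \<cdot> (\<iota> F \<star> \<sigma>) = (\<sigma> \<star> \<iota> F) \<cdot> (\<iota> F \<star> \<sigma>) \<cdot> (\<tau> \<star> \<iota> X)"
    and yb_t: "(\<iota> X \<star> t) \<cdot> (s \<star> \<iota> F) \<cdot> (\<iota> G \<star> \<sigma>) = (\<sigma> \<star> \<iota> G) \<cdot> (\<iota> F \<star> s) \<cdot> (t \<star> \<iota> X)"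
  shows "(\<iota> X \<star> ((\<tau> \<star> \<iota> G) \<cdot> (\<iota> F \<star> t))) \<cdot> (((\<sigma> \<star> \<iota> G) \<cdot> (\<iota> F \<star> s)) \<star> \<iota> F) \<cdot> (\<iota> (F \<diamond> G) \<star> \<sigma>) =
    (\<sigma> \<star> \<iota> (F \<diamond> G)) \<cdot> (\<iota> F \<star> ((\<sigma> \<star> \<iota> G) \<cdot> (\<iota> F \<star> s))) \<cdot> (((\<tau> \<star> \<iota> G) \<cdot> (\<iota> F \<star> t)) \<star> \<iota> X)"
proof -
  note cells = \<sigma> s assms(1,2)
  have "(\<iota> X \<star> ((\<tau> \<star> \<iota> G) \<cdot> (\<iota> F \<star> t))) \<cdot> (((\<sigma> \<star> \<iota> G) \<cdot> (\<iota> F \<star> s)) \<star> \<iota> F) \<cdot> (\<iota> (F \<diamond> G) \<star> \<sigma>) =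
    (\<iota> X \<star> \<tau> \<star> \<iota> G) \<cdot> (\<sigma> \<star> \<iota> (F \<diamond> G)) \<cdot> (\<iota> F \<star> ((\<iota> X \<star> t) \<cdot> (s \<star> \<iota> F) \<cdot> (\<iota> G \<star> \<sigma>)))"
    by (rule diagram_eqI, (rule rep_intros cells | simp)+)
  also have "\<dots> = (((\<iota> X \<star> \<tau>) \<cdot> (\<sigma> \<star> \<iota> F) \<cdot> (\<iota> F \<star> \<sigma>)) \<star> \<iota> G) \<cdot> (\<iota> F \<star> \<iota> F \<star> s) \<cdot> (\<iota> F \<star> t \<star> \<iota> X)"
    unfolding yb_t
    by (rule diagram_eqI, (rule rep_intros cells | simp)+)
  also have "\<dots> = (\<sigma> \<star> \<iota> (F \<diamond> G)) \<cdot> (\<iota> F \<star> ((\<sigma> \<star> \<iota> G) \<cdot> (\<iota> F \<star> s))) \<cdot> (((\<tau> \<star> \<iota> G) \<cdot> (\<iota> F \<star> t)) \<star> \<iota> X)"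
    unfolding yb
    by (rule diagram_eqI, (rule rep_intros cells | simp)+)
  finally show ?thesis .
qed

text \<open>The mirror image of the preceding lemma, for a strand entering from the left. It
  reproduces \<open>yb_u\<close> for \<open>FG\<close>, the form of Yang-Baxter required by
  \<open>smash_cross\<close>.\<close>

lemma cross_braid_left:
  assumes "cell [F, F] [F, F] \<tau>" "cell [F, G] [G, F] u"
    and yb: "(\<iota> X \<star> \<tau>) \<cdot> (\<sigma> \<star> \<iota> F) \<cdot> (\<iota> F \<star> \<sigma>) = (\<sigma> \<star> \<iota> F) \<cdot> (\<iota> F \<star> \<sigma>) \<cdot> (\<tau> \<star> \<iota> X)"
    and yb_u: "(\<iota> X \<star> u) \<cdot> (\<sigma> \<star> \<iota> G) \<cdot> (\<iota> F \<star> s) = (s \<star> \<iota> F) \<cdot> (\<iota> G \<star> \<sigma>) \<cdot> (u \<star> \<iota> X)"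
  shows "(\<iota> X \<star> ((\<iota> F \<star> u) \<cdot> (\<tau> \<star> \<iota> G))) \<cdot> (\<sigma> \<star> \<iota> (F \<diamond> G)) \<cdot> (\<iota> F \<star> ((\<sigma> \<star> \<iota> G) \<cdot> (\<iota> F \<star> s))) =
    (((\<sigma> \<star> \<iota> G) \<cdot> (\<iota> F \<star> s)) \<star> \<iota> F) \<cdot> (\<iota> (F \<diamond> G) \<star> \<sigma>) \<cdot> (((\<iota> F \<star> u) \<cdot> (\<tau> \<star> \<iota> G)) \<star> \<iota> X)"
proof -
  note cells = \<sigma> s assms(1,2)
  have "(\<iota> X \<star> ((\<iota> F \<star> u) \<cdot> (\<tau> \<star> \<iota> G))) \<cdot> (\<sigma> \<star> \<iota> (F \<diamond> G)) \<cdot> (\<iota> F \<star> ((\<sigma> \<star> \<iota> G) \<cdot> (\<iota> F \<star> s))) =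
    (\<iota> X \<star> \<iota> F \<star> u) \<cdot> (((\<iota> X \<star> \<tau>) \<cdot> (\<sigma> \<star> \<iota> F) \<cdot> (\<iota> F \<star> \<sigma>)) \<star> \<iota> G) \<cdot> (\<iota> F \<star> \<iota> F \<star> s)"
    by (rule diagram_eqI, (rule rep_intros cells | simp)+)
  also have "\<dots> = (\<sigma> \<star> \<iota> G \<star> \<iota> F) \<cdot> (\<iota> F \<star> ((\<iota> X \<star> u) \<cdot> (\<sigma> \<star> \<iota> G) \<cdot> (\<iota> F \<star> s))) \<cdot> (\<tau> \<star> \<iota> G \<star> \<iota> X)"
    unfolding yb
    by (rule diagram_eqI, (rule rep_intros cells | simp)+)
  also have "\<dots> = (((\<sigma> \<star> \<iota> G) \<cdot> (\<iota> F \<star> s)) \<star> \<iota> F) \<cdot> (\<iota> (F \<diamond> G) \<star> \<sigma>) \<cdot> (((\<iota> F \<star> u) \<cdot> (\<tau> \<star> \<iota> G)) \<star> \<iota> X)"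
    unfolding yb_u
    by (rule diagram_eqI, (rule rep_intros cells | simp)+)
  finally show ?thesis .
qed

lemma cross_natural:
  assumes [simp]: "X' \<in> E"
    and cells': "cell [F, X'] [X', F] \<sigma>'" "cell [G, X'] [X', G] s'" "cell [X] [X'] f"
    and f_\<sigma>: "(f \<star> \<iota> F) \<cdot> \<sigma> = \<sigma>' \<cdot> (\<iota> F \<star> f)"
    and f_s: "(f \<star> \<iota> G) \<cdot> s = s' \<cdot> (\<iota> G \<star> f)"
  shows "(f \<star> \<iota> (F \<diamond> G)) \<cdot> (\<sigma> \<star> \<iota> G) \<cdot> (\<iota> F \<star> s) = ((\<sigma>' \<star> \<iota> G) \<cdot> (\<iota> F \<star> s')) \<cdot> (\<iota> (F \<diamond> G) \<star> f)"
proof -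
  note cells = \<sigma> s cells'
  have "(f \<star> \<iota> (F \<diamond> G)) \<cdot> (\<sigma> \<star> \<iota> G) \<cdot> (\<iota> F \<star> s) = (((f \<star> \<iota> F) \<cdot> \<sigma>) \<star> \<iota> G) \<cdot> (\<iota> F \<star> s)"
    by (rule diagram_eqI, (rule rep_intros cells | simp)+)
  also have "\<dots> = (\<sigma>' \<star> \<iota> G) \<cdot> (\<iota> F \<star> ((f \<star> \<iota> G) \<cdot> s))"
    unfolding f_\<sigma>
    by (rule diagram_eqI, (rule rep_intros cells | simp)+)
  also have "\<dots> = ((\<sigma>' \<star> \<iota> G) \<cdot> (\<iota> F \<star> s')) \<cdot> (\<iota> (F \<diamond> G) \<star> f)"
    unfolding f_s
    by (rule diagram_eqI, (rule rep_intros cells | simp)+)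
  finally show ?thesis .
qed

end

text \<open>Every equation in the definition of \<open>qb_object\<close> says that some 2-cell
  \<open>f\<close> between powers of \<open>F\<close> slides past \<open>X\<close>. Sliding it past
  \<open>X\<close> and then past \<open>Y\<close> handles all of them at once.\<close>

lemma cross_tensor:
  assumes [simp]: "G \<in> E" "H \<in> E" "X \<in> E" "Y \<in> E"
    and cells: "cell [G, X] [X, G] s" "cell [G, Y] [Y, G] r" "cell [H, X] [X, H] s'" "cell [H, Y] [Y, H] r'" "cell [G] [H] f"
    and s: "(\<iota> X \<star> f) \<cdot> s = s' \<cdot> (f \<star> \<iota> X)"
    and r: "(\<iota> Y \<star> f) \<cdot> r = r' \<cdot> (f \<star> \<iota> Y)"
  shows "(\<iota> (X \<diamond> Y) \<star> f) \<cdot> (\<iota> X \<star> r) \<cdot> (s \<star> \<iota> Y) = ((\<iota> X \<star> r') \<cdot> (s' \<star> \<iota> Y)) \<cdot> (f \<star> \<iota> (X \<diamond> Y))"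
proof -
  have "(\<iota> (X \<diamond> Y) \<star> f) \<cdot> (\<iota> X \<star> r) \<cdot> (s \<star> \<iota> Y) = (\<iota> X \<star> ((\<iota> Y \<star> f) \<cdot> r)) \<cdot> (s \<star> \<iota> Y)"
    by (rule diagram_eqI, (rule rep_intros cells | simp)+)
  also have "\<dots> = (\<iota> X \<star> r') \<cdot> (((\<iota> X \<star> f) \<cdot> s) \<star> \<iota> Y)"
    unfolding r
    by (rule diagram_eqI, (rule rep_intros cells | simp)+)
  also have "\<dots> = ((\<iota> X \<star> r') \<cdot> (s' \<star> \<iota> Y)) \<cdot> (f \<star> \<iota> (X \<diamond> Y))"
    unfolding s
    by (rule diagram_eqI, (rule rep_intros cells | simp)+)
  finally show ?thesis .
qed

text \<open>Here \<open>m \<cdot> (p \<star> \<iota> G)\<close> is the product in which the left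
  factor is first transformed by \<open>p\<close>. It is meant for \<open>p\<close> being left
  multiplication by \<Phi>.\<close>

lemma cross_absorb:
  assumes [simp]: "G \<in> E" "X \<in> E"
    and cells: "cell [G, X] [X, G] s" "cell [G, G] [G] m" "cell [G] [G] p"
    and s_m: "s \<cdot> (m \<star> \<iota> X) = (\<iota> X \<star> m) \<cdot> (s \<star> \<iota> G) \<cdot> (\<iota> G \<star> s)"
    and s_p: "s \<cdot> (p \<star> \<iota> X) = (\<iota> X \<star> p) \<cdot> s"
  shows "s \<cdot> ((m \<cdot> (p \<star> \<iota> G)) \<star> \<iota> X) = (\<iota> X \<star> (m \<cdot> (p \<star> \<iota> G))) \<cdot> (s \<star> \<iota> G) \<cdot> (\<iota> G \<star> s)"
proof -
  have "s \<cdot> ((m \<cdot> (p \<star> \<iota> G)) \<star> \<iota> X) = (s \<cdot> (m \<star> \<iota> X)) \<cdot> (p \<star> \<iota> G \<star> \<iota> X)"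
    by (rule diagram_eqI, (rule rep_intros cells | simp)+)
  also have "\<dots> = (\<iota> X \<star> m) \<cdot> ((s \<cdot> (p \<star> \<iota> X)) \<star> \<iota> G) \<cdot> (\<iota> G \<star> s)"
    unfolding s_m
    by (rule diagram_eqI, (rule rep_intros cells | simp)+)
  also have "\<dots> = (\<iota> X \<star> (m \<cdot> (p \<star> \<iota> G))) \<cdot> (s \<star> \<iota> G) \<cdot> (\<iota> G \<star> s)"
    unfolding s_p
    by (rule diagram_eqI, (rule rep_intros cells | simp)+)
  finally show ?thesis .
qed

lemma cross_mult_element:
  assumes [simp]: "G \<in> E" "X \<in> E"
    and cells: "cell [G, X] [X, G] s" "cell [G, G] [G] m" "cell [] [G] e"
    and s_m: "s \<cdot> (m \<star> \<iota> X) = (\<iota> X \<star> m) \<cdot> (s \<star> \<iota> G) \<cdot> (\<iota> G \<star> s)"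
    and s_e: "s \<cdot> (e \<star> \<iota> X) = \<iota> X \<star> e"
  shows "s \<cdot> ((m \<cdot> (e \<star> \<iota> G)) \<star> \<iota> X) = (\<iota> X \<star> (m \<cdot> (e \<star> \<iota> G))) \<cdot> s"
proof -
  have "s \<cdot> ((m \<cdot> (e \<star> \<iota> G)) \<star> \<iota> X) = (s \<cdot> (m \<star> \<iota> X)) \<cdot> (e \<star> \<iota> G \<star> \<iota> X)"
    by (rule diagram_eqI, (rule rep_intros cells | simp)+)
  also have "\<dots> = (\<iota> X \<star> m) \<cdot> ((s \<cdot> (e \<star> \<iota> X)) \<star> \<iota> G) \<cdot> s"
    unfolding s_m
    by (rule diagram_eqI, (rule rep_intros cells | simp)+)
  also have "\<dots> = (\<iota> X \<star> (m \<cdot> (e \<star> \<iota> G))) \<cdot> s"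
    unfolding s_e
    by (rule diagram_eqI, (rule rep_intros cells | simp)+)
  finally show ?thesis .
qed

end

section \<open>Tambara modules\<close>

sublocale quasi_bimonad \<subseteq> endo_cells K A
  using is_monad by unfold_locales (simp add: quasi_bimonad_data.monad_def)

context quasi_bimonad
begin

lemma F_closed [simp]: "F \<in> E"
  using is_monad by (simp add: monad_def)

lemma structure_cells:
  "cell [F, F] [F] \<mu>" "cell [] [F] \<eta>" "cell [F] [F, F] \<Delta>" "cell [F] [] \<epsilon>"
  "cell [F, F] [F, F] \<tau>" "cell [] [F, F, F] \<Phi>"
  using is_monad \<Delta>_cell \<epsilon>_cell \<tau>_cell \<Phi>_cell by (simp_all add: monad_def cell_def)

section \<open>Crossings of powers of \<open>F\<close> and their crossed multiplications\<close>

definition cross2 :: "'c \<Rightarrow> 'c" where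
  "cross2 \<sigma> = (\<sigma> \<star> F1) \<cdot> (F1 \<star> \<sigma>)"

definition cross3 :: "'c \<Rightarrow> 'c" where
  "cross3 \<sigma> = (\<sigma> \<star> F2) \<cdot> (F1 \<star> cross2 \<sigma>)"

definition mult2 :: 'c where
  "mult2 = (\<mu> \<star> \<mu>) \<cdot> (F1 \<star> \<tau> \<star> F1)"

text \<open>Whereas \<open>cross2 \<tau>\<close> moves two strands across one, this moves one strand
  across two. The former interleaves factors in \<open>mult3\<close>; the latter describes how a
  strand passes the actions of \<open>FF\<close> and \<open>FFF\<close>.\<close>

definition cocross2 :: 'c where
  "cocross2 = (F1 \<star> \<tau>) \<cdot> (\<tau> \<star> F1)"

definition cocross3 :: 'c where
  "cocross3 = (F1 \<star> cocross2) \<cdot> (\<tau> \<star> F2)"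

text \<open>The typing with \<open>F \<diamond> F\<close> as one letter is for instances of the
  lemmas about \<open>FG\<close> with \<open>G\<close> a power of \<open>F\<close>; the other is for
  comparing normal forms.\<close>

lemma cross2_cells:
  assumes "X \<in> E" "cell [F, X] [X, F] \<sigma>"
  shows "cell [F \<diamond> F, X] [X, F \<diamond> F] (cross2 \<sigma>)" "cell [F, F, X] [X, F, F] (cross2 \<sigma>)"
  unfolding cross2_def by (rule cellI, (rule rep_intros assms | simp add: assms)+)+

lemma cross3_cells:
  assumes "X \<in> E" "cell [F, X] [X, F] \<sigma>"
  shows "cell [F \<diamond> F \<diamond> F, X] [X, F \<diamond> F \<diamond> F] (cross3 \<sigma>)" "cell [F, F, F, X] [X, F, F, F] (cross3 \<sigma>)"
  unfolding cross3_def by (rule cellI, (rule rep_intros assms cross2_cells(2) | simp add: assms)+)+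

lemma mult_cells:
  "cell [F \<diamond> F, F \<diamond> F] [F \<diamond> F] mult2" "cell [F, F, F, F] [F, F] mult2"
  "cell [F \<diamond> F \<diamond> F, F \<diamond> F \<diamond> F] [F \<diamond> F \<diamond> F] mult3" "cell [F, F, F, F, F, F] [F, F, F] mult3"
  unfolding mult2_def mult3_def by (rule cellI, (rule rep_intros structure_cells | simp)+)+

lemma cocross_cells:
  "cell [F, F \<diamond> F] [F \<diamond> F, F] cocross2" "cell [F, F, F] [F, F, F] cocross2"
  "cell [F, F, F, F] [F, F, F, F] cocross3"
  unfolding cocross2_def cocross3_def by (rule cellI, (rule rep_intros structure_cells | simp)+)+

text \<open>Exhibits the product of \<open>FFF\<close> as one of \<open>F\<close> with
  \<open>FF\<close>, the shape on which \<open>smash_mult\<close> and \<open>cross_mult\<close>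
  operate.\<close>

lemma mult3_eq: "mult3 = (\<mu> \<star> mult2) \<cdot> (F1 \<star> cross2 \<tau> \<star> F2)"
  unfolding mult2_def mult3_def cross2_def
  by (rule diagram_eqI, (rule rep_intros structure_cells | simp)+)

text \<open>All six equations are brought to the shape of \<open>cross_tensor\<close>. The inserted
  identities are crossings of the empty power of \<open>F\<close>, which occurs as source of \<eta>
  and \<Phi> and as target of \<epsilon>.\<close>

lemma qb_object_iff:
  "qb_object X \<sigma> \<longleftrightarrow>
     X \<in> E \<and> cell [F, X] [X, F] \<sigma> \<and>
     (\<iota> X \<star> \<mu>) \<cdot> cross2 \<sigma> = \<sigma> \<cdot> (\<mu> \<star> \<iota> X) \<and>
     (\<iota> X \<star> \<eta>) \<cdot> \<iota> X = \<sigma> \<cdot> (\<eta> \<star> \<iota> X) \<and>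
     (\<iota> X \<star> \<Delta>) \<cdot> \<sigma> = cross2 \<sigma> \<cdot> (\<Delta> \<star> \<iota> X) \<and>
     (\<iota> X \<star> \<epsilon>) \<cdot> \<sigma> = \<iota> X \<cdot> (\<epsilon> \<star> \<iota> X) \<and>
     (\<iota> X \<star> \<Phi>) \<cdot> \<iota> X = cross3 \<sigma> \<cdot> (\<Phi> \<star> \<iota> X) \<and>
     (\<iota> X \<star> \<tau>) \<cdot> cross2 \<sigma> = cross2 \<sigma> \<cdot> (\<tau> \<star> \<iota> X)"
  (is "_ \<longleftrightarrow> ?r")
proof (cases "X \<in> E \<and> cell [F, X] [X, F] \<sigma>")
  case True
  then have [simp]: "X \<in> E" and \<sigma>: "cell [F, X] [X, F] \<sigma>" by auto
  note cells = structure_cells \<sigma>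
  have
    "(\<iota> X \<star> \<eta>) \<cdot> \<iota> X = \<iota> X \<star> \<eta>" "\<iota> X \<cdot> (\<epsilon> \<star> \<iota> X) = \<epsilon> \<star> \<iota> X" "(\<iota> X \<star> \<Phi>) \<cdot> \<iota> X = \<iota> X \<star> \<Phi>"
    "cross2 \<sigma> \<cdot> (\<Delta> \<star> \<iota> X) = (\<sigma> \<star> F1) \<cdot> (F1 \<star> \<sigma>) \<cdot> (\<Delta> \<star> \<iota> X)"
    "cross2 \<sigma> \<cdot> (\<tau> \<star> \<iota> X) = (\<sigma> \<star> F1) \<cdot> (F1 \<star> \<sigma>) \<cdot> (\<tau> \<star> \<iota> X)"
    "cross3 \<sigma> \<cdot> (\<Phi> \<star> \<iota> X) = (\<sigma> \<star> F2) \<cdot> (F1 \<star> \<sigma> \<star> F1) \<cdot> (F2 \<star> \<sigma>) \<cdot> (\<Phi> \<star> \<iota> X)"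
    unfolding cross2_def cross3_def
    by (rule diagram_eqI, (rule rep_intros cells | simp)+)+
  then show ?thesis
    using \<sigma> by (auto simp: qb_object_def cross2_def cell_def)
next
  case False
  then show ?thesis by (auto simp: qb_object_def cell_def)
qed

abbreviation "ob \<equiv> fst"
abbreviation "cr x \<equiv> fst (snd x)"
abbreviation "ac x \<equiv> snd (snd x)"

lemma Ob_tambara_iff:
  "x \<in> Ob tambara_category \<longleftrightarrow>
     qb_object (ob x) (cr x) \<and> cell [F, ob x] [ob x] (ac x) \<and>
     ac x \<cdot> (\<mu> \<star> \<iota> (ob x)) = ac x \<cdot> (F1 \<star> ac x) \<and> ac x \<cdot> (\<eta> \<star> \<iota> (ob x)) = \<iota> (ob x) \<and>
     cr x \<cdot> (F1 \<star> ac x) = (ac x \<star> F1) \<cdot> (F1 \<star> cr x) \<cdot> (\<tau> \<star> \<iota> (ob x))"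
proof (cases x)
  case (fields X \<sigma> \<nu>)
  then show ?thesis
    by (auto simp: tambara_category_def tambara_object_def qb_category_def left_module_def qb_object_def cell_def)
qed

context
  fixes x assumes x [simp]: "x \<in> Ob tambara_category"
begin

lemma ob_closed [simp]: "ob x \<in> E"
  and cr_cell: "cell [F, ob x] [ob x, F] (cr x)"
  and ac_cell: "cell [F, ob x] [ob x] (ac x)"
  and cr_\<mu>: "(\<iota> (ob x) \<star> \<mu>) \<cdot> cross2 (cr x) = cr x \<cdot> (\<mu> \<star> \<iota> (ob x))"
  and cr_\<eta>: "(\<iota> (ob x) \<star> \<eta>) \<cdot> \<iota> (ob x) = cr x \<cdot> (\<eta> \<star> \<iota> (ob x))"
  and cr_\<Delta>: "(\<iota> (ob x) \<star> \<Delta>) \<cdot> cr x = cross2 (cr x) \<cdot> (\<Delta> \<star> \<iota> (ob x))"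
  and cr_\<epsilon>: "(\<iota> (ob x) \<star> \<epsilon>) \<cdot> cr x = \<iota> (ob x) \<cdot> (\<epsilon> \<star> \<iota> (ob x))"
  and cr_\<Phi>: "(\<iota> (ob x) \<star> \<Phi>) \<cdot> \<iota> (ob x) = cross3 (cr x) \<cdot> (\<Phi> \<star> \<iota> (ob x))"
  and cr_\<tau>: "(\<iota> (ob x) \<star> \<tau>) \<cdot> cross2 (cr x) = cross2 (cr x) \<cdot> (\<tau> \<star> \<iota> (ob x))"
  and ac_assoc: "ac x \<cdot> (\<mu> \<star> \<iota> (ob x)) = ac x \<cdot> (F1 \<star> ac x)"
  and ac_unit: "ac x \<cdot> (\<eta> \<star> \<iota> (ob x)) = \<iota> (ob x)"
  and cr_ac: "cr x \<cdot> (F1 \<star> ac x) = (ac x \<star> F1) \<cdot> (F1 \<star> cr x) \<cdot> (\<tau> \<star> \<iota> (ob x))"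
  using x by (simp_all add: Ob_tambara_iff qb_object_iff)

lemmas tambara_cells = ob_closed cr_cell ac_cell
  cross2_cells[OF ob_closed cr_cell] cross3_cells[OF ob_closed cr_cell]

lemma cross_unit: "cr x \<cdot> (\<eta> \<star> \<iota> (ob x)) = \<iota> (ob x) \<star> \<eta>"
  unfolding cr_\<eta>[symmetric]
  by (rule diagram_eqI, (rule rep_intros structure_cells ob_closed | simp)+)

lemma cr_braid: "(\<iota> (ob x) \<star> \<tau>) \<cdot> (cr x \<star> F1) \<cdot> (F1 \<star> cr x) = (cr x \<star> F1) \<cdot> (F1 \<star> cr x) \<cdot> (\<tau> \<star> \<iota> (ob x))"
proof -
  have "cross2 (cr x) \<cdot> (\<tau> \<star> \<iota> (ob x)) = (cr x \<star> F1) \<cdot> (F1 \<star> cr x) \<cdot> (\<tau> \<star> \<iota> (ob x))"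
    unfolding cross2_def by (rule diagram_eqI, (rule rep_intros structure_cells tambara_cells | simp)+)
  then show ?thesis using cr_\<tau> by (simp add: cross2_def)
qed

lemma cross2_mult:
  "cross2 (cr x) \<cdot> (mult2 \<star> \<iota> (ob x)) =
   (\<iota> (ob x) \<star> mult2) \<cdot> (cross2 (cr x) \<star> F2) \<cdot> (F2 \<star> cross2 (cr x))"
  unfolding cross2_def mult2_def
  by (rule cross_mult)
    (use structure_cells tambara_cells cr_braid cr_\<mu> in \<open>simp_all add: cross2_def\<close>)

lemma cross2_ac:
  "cross2 (cr x) \<cdot> (F2 \<star> ac x) = (ac x \<star> F2) \<cdot> (F1 \<star> cross2 (cr x)) \<cdot> (cross2 \<tau> \<star> \<iota> (ob x))"
  unfolding cross2_def
  by (rule cross_action)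
    (use structure_cells tambara_cells cr_ac in simp_all)

lemma cross2_braid_right:
  "(\<iota> (ob x) \<star> cross2 \<tau>) \<cdot> (cross2 (cr x) \<star> F1) \<cdot> (F2 \<star> cr x) =
   (cr x \<star> F2) \<cdot> (F1 \<star> cross2 (cr x)) \<cdot> (cross2 \<tau> \<star> \<iota> (ob x))"
  unfolding cross2_def
  by (rule cross_braid_right)
    (use structure_cells tambara_cells cr_braid in simp_all)

lemma cross2_braid_left:
  "(\<iota> (ob x) \<star> cocross2) \<cdot> (cr x \<star> F2) \<cdot> (F1 \<star> cross2 (cr x)) =
   (cross2 (cr x) \<star> F1) \<cdot> (F2 \<star> cr x) \<cdot> (cocross2 \<star> \<iota> (ob x))"
  unfolding cross2_def cocross2_def
  by (rule cross_braid_left)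
    (use structure_cells tambara_cells cr_braid in simp_all)

lemma cross2_unit: "cross2 (cr x) \<cdot> ((\<eta> \<star> \<eta>) \<star> \<iota> (ob x)) = \<iota> (ob x) \<star> \<eta> \<star> \<eta>"
proof -
  note cells = structure_cells tambara_cells
  have "cross2 (cr x) \<cdot> ((\<eta> \<star> \<eta>) \<star> \<iota> (ob x)) = (cr x \<star> F1) \<cdot> (\<eta> \<star> (cr x \<cdot> (\<eta> \<star> \<iota> (ob x))))"
    unfolding cross2_def by (rule diagram_eqI, (rule rep_intros cells | simp)+)
  \<comment> \<open>\<open>subst\<close> rewrites only the unit that crosses first; the right-hand
    side must keep its own redex for the next step.\<close>
  also have "\<dots> = (cr x \<cdot> (\<eta> \<star> \<iota> (ob x))) \<star> \<eta>"
    by (subst cross_unit) (rule diagram_eqI, (rule rep_intros cells | simp)+)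
  also have "\<dots> = \<iota> (ob x) \<star> \<eta> \<star> \<eta>"
    unfolding cross_unit by (rule diagram_eqI, (rule rep_intros cells | simp)+)
  finally show ?thesis .
qed

lemma cross3_mult:
  "cross3 (cr x) \<cdot> (mult3 \<star> \<iota> (ob x)) =
   (\<iota> (ob x) \<star> mult3) \<cdot> (cross3 (cr x) \<star> F3) \<cdot> (F3 \<star> cross3 (cr x))"
  unfolding cross3_def mult3_eq
  by (rule cross_mult)
    (use structure_cells tambara_cells mult_cells cross2_cells[of F \<tau>] cross2_braid_right cr_\<mu> cross2_mult
      in \<open>simp_all add: cross2_def\<close>)

lemma cross3_ac:
  "cross3 (cr x) \<cdot> (F3 \<star> ac x) = (ac x \<star> F3) \<cdot> (F1 \<star> cross3 (cr x)) \<cdot> (cross3 \<tau> \<star> \<iota> (ob x))"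
  unfolding cross3_def
  by (rule cross_action)
    (use structure_cells tambara_cells cross2_cells[of F \<tau>] cr_ac cross2_ac in simp_all)

end

section \<open>Actions of powers of \<open>F\<close> and the tensor product\<close>

definition act2 where
  "act2 x y = smash F (ac x) (cr x) (ac y) (ob y)"

definition act3 where
  "act3 x y z = smash F (ac x) (cross2 (cr x)) (act2 y z) (ob y \<diamond> ob z)"

definition act4 where
  "act4 w x y z = smash F (ac w) (cross3 (cr w)) (act3 x y z) (ob x \<diamond> ob y \<diamond> ob z)"

lemma tensor_proj [simp]:
  "ob (tambara_tensor x y) = ob x \<diamond> ob y"
  "cr (tambara_tensor x y) = (\<iota> (ob x) \<star> cr y) \<cdot> (cr x \<star> \<iota> (ob y))"
  "ac (tambara_tensor x y) =
    (ac x \<star> ac y) \<cdot> (F1 \<star> cr x \<star> \<iota> (ob y)) \<cdot> (\<Delta> \<star> \<iota> (ob x) \<star> \<iota> (ob y))"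
  by (cases x; cases y; simp)+

context
  fixes x y assumes x [simp]: "x \<in> Ob tambara_category" and y [simp]: "y \<in> Ob tambara_category"
begin

lemma act2_cells:
  "cell [F, F, ob x, ob y] [ob x, ob y] (act2 x y)"
  "cell [F \<diamond> F, ob x \<diamond> ob y] [ob x \<diamond> ob y] (act2 x y)"
  unfolding act2_def
  by (rule cellI, rule rep_cell, rule cell_smash[where G = F];
      use tambara_cells[OF x] tambara_cells[OF y] in simp)+

lemma act2_mult: "act2 x y \<cdot> (F2 \<star> act2 x y) = act2 x y \<cdot> (mult2 \<star> \<iota> (ob x \<diamond> ob y))"
  unfolding act2_def mult2_def
  by (rule smash_mult)
    (use structure_cells tambara_cells[OF x] tambara_cells[OF y] cr_\<mu>[OF x] cr_ac[OF x]
      ac_assoc[OF x] ac_assoc[OF y] in \<open>simp_all add: cross2_def\<close>)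

lemma act2_unit: "act2 x y \<cdot> ((\<eta> \<star> \<eta>) \<star> \<iota> (ob x \<diamond> ob y)) = \<iota> (ob x \<diamond> ob y)"
  unfolding act2_def
  by (rule smash_unit)
    (use structure_cells tambara_cells[OF x] tambara_cells[OF y] cross_unit[OF x]
      ac_unit[OF x] ac_unit[OF y] in simp_all)

lemma act2_cross:
  "cr (tambara_tensor x y) \<cdot> (F1 \<star> act2 x y) =
   (act2 x y \<star> F1) \<cdot> (F2 \<star> cr (tambara_tensor x y)) \<cdot> (cocross2 \<star> \<iota> (ob x \<diamond> ob y))"
  unfolding act2_def tensor_proj cocross2_def
  by (rule smash_cross)
    (use structure_cells tambara_cells[OF x] tambara_cells[OF y] cr_braid[OF x] cr_ac[OF x] cr_ac[OF y]
      in simp_all)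

lemma ac_tensor: "ac (tambara_tensor x y) = act2 x y \<cdot> (\<Delta> \<star> \<iota> (ob x \<diamond> ob y))"
  unfolding tensor_proj act2_def smash_def
  by (rule diagram_eqI, (rule rep_intros structure_cells tambara_cells[OF x] tambara_cells[OF y] | simp)+)

lemma tensor_cells:
  "cell [F, ob x, ob y] [ob x, ob y, F] (cr (tambara_tensor x y))"
  "cell [F, ob x, ob y] [ob x, ob y] (ac (tambara_tensor x y))"
  unfolding tensor_proj
  by (rule cellI, (rule rep_intros structure_cells tambara_cells[OF x] tambara_cells[OF y] | simp)+)+

lemma cross_tensor_eqs:
  "cross2 (cr (tambara_tensor x y)) = (\<iota> (ob x) \<star> cross2 (cr y)) \<cdot> (cross2 (cr x) \<star> \<iota> (ob y))"
  "cross3 (cr (tambara_tensor x y)) = (\<iota> (ob x) \<star> cross3 (cr y)) \<cdot> (cross3 (cr x) \<star> \<iota> (ob y))"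
  unfolding tensor_proj cross2_def cross3_def
  by (rule diagram_eqI, (rule rep_intros tambara_cells[OF x] tambara_cells[OF y] | simp)+)+

lemma qb_object_tensor: "qb_object (ob (tambara_tensor x y)) (cr (tambara_tensor x y))"
proof -
  have c: "cell [F, ob x \<diamond> ob y] [ob x \<diamond> ob y, F] (cr (tambara_tensor x y))"
    using tensor_cells(1) by (simp add: cell_def)
  have i: "cell [Id1 K A, ob x] [ob x, Id1 K A] (\<iota> (ob x))" "cell [Id1 K A, ob y] [ob y, Id1 K A] (\<iota> (ob y))"
    by (simp_all add: cell_def Id2_closed)
  have s: "cell [F \<diamond> F] [F] \<mu>" "cell [Id1 K A] [F] \<eta>" "cell [F] [F \<diamond> F] \<Delta>" "cell [F] [Id1 K A] \<epsilon>"
    "cell [F \<diamond> F] [F \<diamond> F] \<tau>" "cell [Id1 K A] [F \<diamond> F \<diamond> F] \<Phi>"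
    using structure_cells by (simp_all add: cell_def)
  \<comment> \<open>The identity of \<open>XY\<close> is read as the crossing of the empty power
    past \<open>X\<close> and then \<open>Y\<close>, so that \<open>cross_tensor\<close> also
    matches the equations for \<eta>, \<epsilon> and \<Phi>.\<close>
  have ii: "\<iota> (ob x \<diamond> ob y) = (\<iota> (ob x) \<star> \<iota> (ob y)) \<cdot> (\<iota> (ob x) \<star> \<iota> (ob y))"
    by (rule diagram_eqI, (rule rep_intros | simp)+)
  note cs = i s tambara_cells[OF x] tambara_cells[OF y]
  note tens = cross_tensor[OF _ _ ob_closed[OF x] ob_closed[OF y]]
  show ?thesis
    unfolding qb_object_iff cross_tensor_eqs
    apply (intro conjI)
    subgoal by simp
    subgoal using c by simp
    subgoal unfolding tensor_proj by (rule tens) (use cs cr_\<mu>[OF x] cr_\<mu>[OF y] in simp_all)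
    subgoal unfolding tensor_proj by (subst ii, rule tens) (use cs cr_\<eta>[OF x] cr_\<eta>[OF y] in simp_all)
    subgoal unfolding tensor_proj by (rule tens) (use cs cr_\<Delta>[OF x] cr_\<Delta>[OF y] in simp_all)
    subgoal unfolding tensor_proj by (subst (2) ii, rule tens) (use cs cr_\<epsilon>[OF x] cr_\<epsilon>[OF y] in simp_all)
    subgoal unfolding tensor_proj by (subst (2) ii, rule tens) (use cs cr_\<Phi>[OF x] cr_\<Phi>[OF y] in simp_all)
    subgoal unfolding tensor_proj by (rule tens) (use cs cr_\<tau>[OF x] cr_\<tau>[OF y] in simp_all)
    done
qed

text \<open>\<open>F\<close> acts through \<Delta>, which respects products (\<open>mult2\<close> on
  \<open>FF\<close>) and units by \<open>\<Delta>_\<mu>\<close> and \<open>\<Delta>_\<eta>\<close>;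
  this gives a module. Left comonadicity lets a strand that has to cross both outputs of \<Delta>
  cross its input instead, which gives the Tambara condition.\<close>

lemma tensor_closed: "tambara_tensor x y \<in> Ob tambara_category"
proof -
  let ?t = "tambara_tensor x y" and ?P = "ob x \<diamond> ob y" and ?I = "\<iota> (ob x \<diamond> ob y)"
  note cells = structure_cells tensor_cells act2_cells(1) mult_cells(2) cocross_cells(2)
  have "ac ?t \<cdot> (F1 \<star> ac ?t) = (act2 x y \<cdot> (F2 \<star> act2 x y)) \<cdot> (\<Delta> \<star> \<Delta> \<star> ?I)"
    unfolding ac_tensor
    by (rule diagram_eqI, (rule rep_intros cells | simp)+)
  also have "\<dots> = act2 x y \<cdot> (((\<mu> \<star> \<mu>) \<cdot> (F1 \<star> \<tau> \<star> F1) \<cdot> (\<Delta> \<star> \<Delta>)) \<star> ?I)"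
    unfolding act2_mult unfolding mult2_def
    by (rule diagram_eqI, (rule rep_intros cells | simp)+)
  also have "\<dots> = ac ?t \<cdot> (\<mu> \<star> ?I)"
    unfolding \<Delta>_\<mu>[symmetric] ac_tensor
    by (rule diagram_eqI, (rule rep_intros cells | simp)+)
  finally have assoc: "ac ?t \<cdot> (\<mu> \<star> ?I) = ac ?t \<cdot> (F1 \<star> ac ?t)" by simp
  have "ac ?t \<cdot> (\<eta> \<star> ?I) = act2 x y \<cdot> ((\<Delta> \<cdot> \<eta>) \<star> ?I)"
    unfolding ac_tensor
    by (rule diagram_eqI, (rule rep_intros cells | simp)+)
  then have unit: "ac ?t \<cdot> (\<eta> \<star> ?I) = ?I"
    by (simp add: \<Delta>_\<eta> act2_unit)
  have "cr ?t \<cdot> (F1 \<star> ac ?t) = (cr ?t \<cdot> (F1 \<star> act2 x y)) \<cdot> (F1 \<star> \<Delta> \<star> ?I)"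
    unfolding ac_tensor
    by (rule diagram_eqI, (rule rep_intros cells | simp)+)
  also have "\<dots> = (act2 x y \<star> F1) \<cdot> (F2 \<star> cr ?t) \<cdot> (((F1 \<star> \<tau>) \<cdot> (\<tau> \<star> F1) \<cdot> (F1 \<star> \<Delta>)) \<star> ?I)"
    unfolding act2_cross unfolding cocross2_def
    by (rule diagram_eqI, (rule rep_intros cells | simp)+)
  also have "(F1 \<star> \<tau>) \<cdot> (\<tau> \<star> F1) \<cdot> (F1 \<star> \<Delta>) = (\<Delta> \<star> F1) \<cdot> \<tau>"
    using \<tau>_left_comonadic by (simp add: left_comonadic_def)
  also have "(act2 x y \<star> F1) \<cdot> (F2 \<star> cr ?t) \<cdot> (((\<Delta> \<star> F1) \<cdot> \<tau>) \<star> ?I) =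
      (ac ?t \<star> F1) \<cdot> (F1 \<star> cr ?t) \<cdot> (\<tau> \<star> ?I)"
    unfolding ac_tensor
    by (rule diagram_eqI, (rule rep_intros cells | simp)+)
  finally have cross: "cr ?t \<cdot> (F1 \<star> ac ?t) = (ac ?t \<star> F1) \<cdot> (F1 \<star> cr ?t) \<cdot> (\<tau> \<star> ?I)" .
  have "cell [F, ?P] [?P] (ac ?t)"
    using tensor_cells(2) by (simp add: cell_def)
  then show ?thesis
    unfolding Ob_tambara_iff using qb_object_tensor assoc unit cross by simp
qed

end

section \<open>The associativity constraint\<close>

lemma Hom_tambara_iff:
  assumes "x \<in> Ob tambara_category" "y \<in> Ob tambara_category"
  shows "f \<in> Hom tambara_category x y \<longleftrightarrow> cell [ob x] [ob y] f \<and>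
    (f \<star> F1) \<cdot> cr x = cr y \<cdot> (F1 \<star> f) \<and> f \<cdot> ac x = ac y \<cdot> (F1 \<star> f)"
  using ob_closed[OF assms(1)] ob_closed[OF assms(2)]
  by (cases x; cases y) (auto simp: tambara_category_def qb_category_def cell_def)

context
  fixes x x' f assumes x [simp]: "x \<in> Ob tambara_category" and x' [simp]: "x' \<in> Ob tambara_category"
    and f: "f \<in> Hom tambara_category x x'"
begin

lemma Hom_cell: "cell [ob x] [ob x'] f"
  and Hom_cr: "(f \<star> F1) \<cdot> cr x = cr x' \<cdot> (F1 \<star> f)"
  and Hom_ac: "f \<cdot> ac x = ac x' \<cdot> (F1 \<star> f)"
  using Hom_tambara_iff[OF x x'] f by simp_all

lemma Hom_cross2: "(f \<star> F2) \<cdot> cross2 (cr x) = cross2 (cr x') \<cdot> (F2 \<star> f)"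
  unfolding cross2_def
  by (rule cross_natural) (use tambara_cells[OF x] tambara_cells[OF x'] Hom_cell Hom_cr in simp_all)

end

lemma act2_natural:
  assumes x [simp]: "x \<in> Ob tambara_category" and x' [simp]: "x' \<in> Ob tambara_category"
    and y [simp]: "y \<in> Ob tambara_category" and y' [simp]: "y' \<in> Ob tambara_category"
    and f: "f \<in> Hom tambara_category x x'" and g: "g \<in> Hom tambara_category y y'"
  shows "(f \<star> g) \<cdot> act2 x y = act2 x' y' \<cdot> (F2 \<star> f \<star> g)"
  unfolding act2_def
  by (rule smash_natural)
    (use tambara_cells[OF x] tambara_cells[OF x'] tambara_cells[OF y] tambara_cells[OF y']
      Hom_cell[OF x x' f] Hom_cr[OF x x' f] Hom_ac[OF x x' f] Hom_cell[OF y y' g] Hom_ac[OF y y' g] in simp_all)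

lemma Hom_tensor:
  assumes x [simp]: "x \<in> Ob tambara_category" and x' [simp]: "x' \<in> Ob tambara_category"
    and y [simp]: "y \<in> Ob tambara_category" and y' [simp]: "y' \<in> Ob tambara_category"
    and f: "f \<in> Hom tambara_category x x'" and g: "g \<in> Hom tambara_category y y'"
  shows "f \<star> g \<in> Hom tambara_category (tambara_tensor x y) (tambara_tensor x' y')"
proof -
  note cells = tambara_cells[OF x] tambara_cells[OF x'] tambara_cells[OF y] tambara_cells[OF y']
    Hom_cell[OF x x' f] Hom_cell[OF y y' g] structure_cells act2_cells(1)
    have "((f \<star> g) \<star> F1) \<cdot> cr (tambara_tensor x y) =
      (f \<star> ((g \<star> F1) \<cdot> cr y)) \<cdot> (cr x \<star> \<iota> (ob y))"
    unfolding tensor_proj by (rule diagram_eqI, (rule rep_intros cells | simp)+)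
  also have "\<dots> = (\<iota> (ob x') \<star> cr y') \<cdot> (((f \<star> F1) \<cdot> cr x) \<star> g)"
    unfolding Hom_cr[OF y y' g] by (rule diagram_eqI, (rule rep_intros cells | simp)+)
  also have "\<dots> = cr (tambara_tensor x' y') \<cdot> (F1 \<star> f \<star> g)"
    unfolding Hom_cr[OF x x' f] tensor_proj
    by (rule diagram_eqI, (rule rep_intros cells | simp)+)
  finally have cross: "((f \<star> g) \<star> F1) \<cdot> cr (tambara_tensor x y) = cr (tambara_tensor x' y') \<cdot> (F1 \<star> f \<star> g)" .
  have "(f \<star> g) \<cdot> ac (tambara_tensor x y) = ((f \<star> g) \<cdot> act2 x y) \<cdot> (\<Delta> \<star> \<iota> (ob x \<diamond> ob y))"
    unfolding ac_tensor[OF x y] by (rule diagram_eqI, (rule rep_intros cells | simp)+)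
  also have "\<dots> = ac (tambara_tensor x' y') \<cdot> (F1 \<star> f \<star> g)"
    unfolding act2_natural[OF x x' y y' f g] ac_tensor[OF x' y']
    by (rule diagram_eqI, (rule rep_intros cells | simp)+)
  finally have ac: "(f \<star> g) \<cdot> ac (tambara_tensor x y) = ac (tambara_tensor x' y') \<cdot> (F1 \<star> f \<star> g)" .
  have "cell [ob x \<diamond> ob y] [ob x' \<diamond> ob y'] (f \<star> g)"
    by (rule cellI, (rule rep_intros cells | simp)+)
  with cross ac show ?thesis
    using Hom_tambara_iff[OF tensor_closed[OF x y] tensor_closed[OF x' y']] by simp
qed

lemma tambara_assoc_proj:
  "tambara_assoc x y z = (ac x \<star> ac y \<star> ac z) \<cdot> (F1 \<star> cr x \<star> cr y \<star> \<iota> (ob z)) \<cdot>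
     (F1 \<star> F1 \<star> cr x \<star> \<iota> (ob y) \<star> \<iota> (ob z)) \<cdot> (\<Phi> \<star> \<iota> (ob x) \<star> \<iota> (ob y) \<star> \<iota> (ob z))"
  by (cases x; cases y; cases z; simp)

text \<open>In the axiom the second \<Delta> comes after a crossing. Left comonadicity moves it in
  front, where the left-hand side becomes the product of \<Phi> with the iterated coproduct.\<close>

lemma mult3_quasi_coassociative:
  "mult3 \<cdot> (\<Phi> \<star> ((\<Delta> \<star> F1) \<cdot> \<Delta>)) = mult3 \<cdot> (((F1 \<star> \<Delta>) \<cdot> \<Delta>) \<star> \<Phi>)"
proof -
  have "mult3 \<cdot> (\<Phi> \<star> ((\<Delta> \<star> F1) \<cdot> \<Delta>)) =
    (\<mu> \<star> \<mu> \<star> \<mu>) \<cdot> (F1 \<star> \<tau> \<star> F3) \<cdot> (F2 \<star> ((F1 \<star> \<tau>) \<cdot> (\<tau> \<star> F1) \<cdot> (F1 \<star> \<Delta>)) \<star> F1) \<cdot> (\<Phi> \<star> \<Delta>)"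
    unfolding mult3_def by (rule diagram_eqI, (rule rep_intros structure_cells | simp)+)
  also have "(F1 \<star> \<tau>) \<cdot> (\<tau> \<star> F1) \<cdot> (F1 \<star> \<Delta>) = (\<Delta> \<star> F1) \<cdot> \<tau>"
    using \<tau>_left_comonadic by (simp add: left_comonadic_def)
  also have "(\<mu> \<star> \<mu> \<star> \<mu>) \<cdot> (F1 \<star> \<tau> \<star> F3) \<cdot> (F2 \<star> ((\<Delta> \<star> F1) \<cdot> \<tau>) \<star> F1) \<cdot> (\<Phi> \<star> \<Delta>) =
    (\<mu> \<star> \<mu> \<star> F1) \<cdot> (F1 \<star> \<tau> \<star> F2) \<cdot> (F2 \<star> \<Delta> \<star> \<mu>) \<cdot> (F2 \<star> \<tau> \<star> F1) \<cdot> (\<Phi> \<star> \<Delta>)"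
    by (rule diagram_eqI, (rule rep_intros structure_cells | simp)+)
  also have "\<dots> = mult3 \<cdot> (((F1 \<star> \<Delta>) \<cdot> \<Delta>) \<star> \<Phi>)"
    using \<Phi>_quasi_coassociative by (simp add: quasi_coassociative_def)
  finally show ?thesis .
qed

section \<open>The action of \<open>FFF\<close> on three modules\<close>

context
  fixes x y z assumes x [simp]: "x \<in> Ob tambara_category" and y [simp]: "y \<in> Ob tambara_category"
    and z [simp]: "z \<in> Ob tambara_category"
begin

lemmas cells3 = structure_cells tambara_cells[OF x] tambara_cells[OF y] tambara_cells[OF z]

lemma act3_cells:
  "cell [F, F, F, ob x, ob y, ob z] [ob x, ob y, ob z] (act3 x y z)"
  "cell [F \<diamond> F \<diamond> F, ob x \<diamond> ob y \<diamond> ob z] [ob x \<diamond> ob y \<diamond> ob z] (act3 x y z)"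
  unfolding act3_def
  by (rule cellI, rule rep_cell, rule cell_smash[where G = "F \<diamond> F"];
      use tambara_cells[OF x] tambara_cells[OF y] tambara_cells[OF z] act2_cells[OF y z] in simp)+

lemma act3_mult: "act3 x y z \<cdot> (F3 \<star> act3 x y z) = act3 x y z \<cdot> (mult3 \<star> \<iota> (ob x \<diamond> ob y \<diamond> ob z))"
  unfolding act3_def mult3_eq
  by (rule smash_mult)
    (use cells3 act2_cells[OF y z] cross2_cells[of F \<tau>] mult_cells cross2_mult[OF x] cross2_ac[OF x]
      ac_assoc[OF x] act2_mult[OF y z] in simp_all)

lemma act3_unit:
  "act3 x y z \<cdot> ((\<eta> \<star> \<eta> \<star> \<eta>) \<star> \<iota> (ob x \<diamond> ob y \<diamond> ob z)) = \<iota> (ob x \<diamond> ob y \<diamond> ob z)"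
proof -
  have "cell [] [F \<diamond> F] (\<eta> \<star> \<eta>)"
    by (rule cellI, (rule rep_intros structure_cells | simp)+)
  then show ?thesis
    unfolding act3_def
    by (intro smash_unit)
      (use cells3 act2_cells[OF y z] cross2_unit[OF x] ac_unit[OF x] act2_unit[OF y z] in simp_all)
qed

lemma act3_cross:
  "cr (tambara_tensor x (tambara_tensor y z)) \<cdot> (F1 \<star> act3 x y z) =
   (act3 x y z \<star> F1) \<cdot> (F3 \<star> cr (tambara_tensor x (tambara_tensor y z))) \<cdot>
   (cocross3 \<star> \<iota> (ob x \<diamond> ob y \<diamond> ob z))"
proof -
  have "cell [F, ob y \<diamond> ob z] [ob y \<diamond> ob z, F] (cr (tambara_tensor y z))"
    using tensor_cells(1)[OF y z] by (simp add: cell_def)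
  then show ?thesis
    unfolding act3_def tensor_proj(2)[of x] cocross3_def
    unfolding tensor_proj(1)
    by (intro smash_cross)
      (use cells3 act2_cells[OF y z] cocross_cells cr_ac[OF x] act2_cross[OF y z] cross2_braid_left[OF x]
        in simp_all)
qed

lemma assoc_eq: "tambara_assoc x y z = act3 x y z \<cdot> (\<Phi> \<star> \<iota> (ob x \<diamond> ob y \<diamond> ob z))"
  unfolding tambara_assoc_proj act3_def act2_def smash_def cross2_def
  by (rule diagram_eqI, (rule rep_intros cells3 | simp)+)

lemma assoc_cells:
  "cell [ob x, ob y, ob z] [ob x, ob y, ob z] (tambara_assoc x y z)"
  "cell [ob x \<diamond> ob y \<diamond> ob z] [ob x \<diamond> ob y \<diamond> ob z] (tambara_assoc x y z)"
  unfolding assoc_eq by (rule cellI, (rule rep_intros act3_cells(1) cells3 | simp)+)+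

text \<open>The inner \<Delta> acts on the strand that crosses nothing before it, so interchange
  suffices.\<close>

lemma ac_tensor_left:
  "ac (tambara_tensor (tambara_tensor x y) z) =
   act3 x y z \<cdot> (((\<Delta> \<star> F1) \<cdot> \<Delta>) \<star> \<iota> (ob x \<diamond> ob y \<diamond> ob z))"
  unfolding tensor_proj act3_def act2_def smash_def cross2_def
  by (rule diagram_eqI, (rule rep_intros cells3 | simp)+)

text \<open>In this bracketing the inner \<Delta> acts on a strand that has already crossed
  \<open>X\<close>, so it must be pulled back by \<open>cr_\<Delta>\<close>.\<close>

lemma ac_tensor_right:
  "ac (tambara_tensor x (tambara_tensor y z)) =
   act3 x y z \<cdot> (((F1 \<star> \<Delta>) \<cdot> \<Delta>) \<star> \<iota> (ob x \<diamond> ob y \<diamond> ob z))"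
proof -
  have "ac (tambara_tensor x (tambara_tensor y z)) =
    (ac x \<star> act2 y z) \<cdot> (F1 \<star> ((\<iota> (ob x) \<star> \<Delta>) \<cdot> cr x) \<star> \<iota> (ob y \<diamond> ob z)) \<cdot>
    (\<Delta> \<star> \<iota> (ob x \<diamond> ob y \<diamond> ob z))"
    unfolding tensor_proj(3)[of x] ac_tensor[OF y z] unfolding tensor_proj
    by (rule diagram_eqI, (rule rep_intros cells3 act2_cells(1)[OF y z] | simp)+)
  also have "\<dots> = act3 x y z \<cdot> (((F1 \<star> \<Delta>) \<cdot> \<Delta>) \<star> \<iota> (ob x \<diamond> ob y \<diamond> ob z))"
    unfolding cr_\<Delta>[OF x] act3_def smash_def
    by (rule diagram_eqI, (rule rep_intros cells3 act2_cells(1)[OF y z] | simp)+)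
  finally show ?thesis .
qed

text \<open>The two bracketings differ at most in their actions, so \<alpha> is a 2-cell from one
  underlying 1-cell with one crossing to itself.\<close>

lemma cr_tensor_assoc:
  "cr (tambara_tensor (tambara_tensor x y) z) = cr (tambara_tensor x (tambara_tensor y z))"
  unfolding tensor_proj
  by (rule diagram_eqI, (rule rep_intros cells3 | simp)+)

lemma assoc_linear:
  "tambara_assoc x y z \<cdot> ac (tambara_tensor (tambara_tensor x y) z) =
   ac (tambara_tensor x (tambara_tensor y z)) \<cdot> (F1 \<star> tambara_assoc x y z)"
proof -
  let ?I = "\<iota> (ob x \<diamond> ob y \<diamond> ob z)"
  note cells = structure_cells act3_cells(1) mult_cells(4)
  have "tambara_assoc x y z \<cdot> ac (tambara_tensor (tambara_tensor x y) z) =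
    (act3 x y z \<cdot> (F3 \<star> act3 x y z)) \<cdot> (\<Phi> \<star> ((\<Delta> \<star> F1) \<cdot> \<Delta>) \<star> ?I)"
    unfolding assoc_eq ac_tensor_left by (rule diagram_eqI, (rule rep_intros cells | simp)+)
  also have "\<dots> = act3 x y z \<cdot> ((mult3 \<cdot> (\<Phi> \<star> ((\<Delta> \<star> F1) \<cdot> \<Delta>))) \<star> ?I)"
    unfolding act3_mult by (rule diagram_eqI, (rule rep_intros cells | simp)+)
  also have "\<dots> = (act3 x y z \<cdot> (mult3 \<star> ?I)) \<cdot> (((F1 \<star> \<Delta>) \<cdot> \<Delta>) \<star> \<Phi> \<star> ?I)"
    unfolding mult3_quasi_coassociative by (rule diagram_eqI, (rule rep_intros cells | simp)+)
  also have "\<dots> = ac (tambara_tensor x (tambara_tensor y z)) \<cdot> (F1 \<star> tambara_assoc x y z)"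
    unfolding act3_mult[symmetric] assoc_eq ac_tensor_right
    by (rule diagram_eqI, (rule rep_intros cells | simp)+)
  finally show ?thesis .
qed

text \<open>Stated for an arbitrary pair of elements, so that exchanging the roles of \<Phi> and its
  convolution inverse yields both composites.\<close>

lemma assoc_inverse:
  assumes \<Psi>: "\<Psi> \<in> Cell2 K (Id1 K A) (F \<diamond> F \<diamond> F)" and \<Psi>': "\<Psi>' \<in> Cell2 K (Id1 K A) (F \<diamond> F \<diamond> F)"
    and eq: "convolution \<Psi> \<Psi>' = \<eta> \<star> \<eta> \<star> \<eta>"
  shows "(act3 x y z \<cdot> (\<Psi> \<star> \<iota> (ob x \<diamond> ob y \<diamond> ob z))) \<cdot> (act3 x y z \<cdot> (\<Psi>' \<star> \<iota> (ob x \<diamond> ob y \<diamond> ob z))) =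
    \<iota> (ob x \<diamond> ob y \<diamond> ob z)"
proof -
  let ?I = "\<iota> (ob x \<diamond> ob y \<diamond> ob z)"
  have "cell [] [F, F, F] \<Psi>" "cell [] [F, F, F] \<Psi>'" using \<Psi> \<Psi>' by (simp_all add: cell_def)
  note cells = this act3_cells(1) mult_cells(4)
  have "(act3 x y z \<cdot> (\<Psi> \<star> ?I)) \<cdot> (act3 x y z \<cdot> (\<Psi>' \<star> ?I)) = (act3 x y z \<cdot> (F3 \<star> act3 x y z)) \<cdot> (\<Psi> \<star> \<Psi>' \<star> ?I)"
    by (rule diagram_eqI, (rule rep_intros cells | simp)+)
  also have "\<dots> = act3 x y z \<cdot> (convolution \<Psi> \<Psi>' \<star> ?I)"
    unfolding act3_mult convolution_def by (rule diagram_eqI, (rule rep_intros cells | simp)+)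
  finally show ?thesis using eq act3_unit by simp
qed

end

lemma assoc_natural:
  assumes x [simp]: "x \<in> Ob tambara_category" and x' [simp]: "x' \<in> Ob tambara_category"
    and y [simp]: "y \<in> Ob tambara_category" and y' [simp]: "y' \<in> Ob tambara_category"
    and z [simp]: "z \<in> Ob tambara_category" and z' [simp]: "z' \<in> Ob tambara_category"
    and f: "f \<in> Hom tambara_category x x'" and g: "g \<in> Hom tambara_category y y'"
    and h: "h \<in> Hom tambara_category z z'"
  shows "tambara_assoc x' y' z' \<cdot> ((f \<star> g) \<star> h) = (f \<star> g \<star> h) \<cdot> tambara_assoc x y z"
proof -
  note hom = Hom_cell[OF x x' f] Hom_cell[OF y y' g] Hom_cell[OF z z' h]
  have gh: "cell [ob y \<diamond> ob z] [ob y' \<diamond> ob z'] (g \<star> h)"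
    by (rule cellI, (rule rep_intros hom | simp)+)
  have nat: "(f \<star> g \<star> h) \<cdot> act3 x y z = act3 x' y' z' \<cdot> (F3 \<star> f \<star> g \<star> h)"
    unfolding act3_def
    by (rule smash_natural)
      (use x x' y y' z z' hom gh tambara_cells[OF x] tambara_cells[OF x'] act2_cells(2)[OF y z] act2_cells(2)[OF y' z']
         Hom_ac[OF x x' f] Hom_cross2[OF x x' f] act2_natural[OF y y' z z' g h] in simp_all)
  note cells = hom structure_cells act3_cells(1)[OF x y z] act3_cells(1)[OF x' y' z']
  have "tambara_assoc x' y' z' \<cdot> ((f \<star> g) \<star> h) = (act3 x' y' z' \<cdot> (F3 \<star> f \<star> g \<star> h)) \<cdot> (\<Phi> \<star> \<iota> (ob x \<diamond> ob y \<diamond> ob z))"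
    unfolding assoc_eq[OF x' y' z']
    by (rule diagram_eqI, (rule rep_intros cells | simp)+)
  also have "\<dots> = (f \<star> g \<star> h) \<cdot> tambara_assoc x y z"
    unfolding nat[symmetric] assoc_eq[OF x y z]
    by (rule diagram_eqI, (rule rep_intros cells | simp)+)
  finally show ?thesis .
qed

section \<open>The pentagon\<close>

definition mult4 :: 'c where
  "mult4 = (\<mu> \<star> mult3) \<cdot> (F1 \<star> cross3 \<tau> \<star> F3)"

text \<open>
  The bracketing is essential: since \<open>\<tau>\<close> is not assumed to satisfy the Yang-Baxter equation, the
  multiplication of \<open>FFF\<close> need not be associative. For the same reason the pentagon does
  not treat the whiskered constraint \<open>\<iota> W \<star> \<alpha>\<close> as the action of \<open>\<eta> \<star> \<Phi>\<close>.
\<close>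

definition \<Phi>_mult :: 'c where
  "\<Phi>_mult = mult3 \<cdot> ((mult3 \<cdot> (\<Phi> \<star> F3)) \<star> F3)"

text \<open>The product of \<open>FFFF\<close>, except that the last three legs of the left factor
  are multiplied by \<Phi> from the left before they meet those of the right factor. This is what a
  constraint on the last three modules does to a product of two actions.\<close>

definition mult4_\<Phi> :: 'c where
  "mult4_\<Phi> = (\<mu> \<star> \<Phi>_mult) \<cdot> (F1 \<star> cross3 \<tau> \<star> F3)"

lemma \<Phi>_mult_cells:
  "cell [F, F, F, F, F, F] [F, F, F] \<Phi>_mult"
  "cell [F \<diamond> F \<diamond> F, F \<diamond> F \<diamond> F] [F \<diamond> F \<diamond> F] \<Phi>_mult"
  unfolding \<Phi>_mult_def by (rule cellI, (rule rep_intros structure_cells mult_cells(4) | simp)+)+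

lemma mult4_cells:
  "cell [F, F, F, F, F, F, F, F] [F, F, F, F] mult4"
  "cell [F, F, F, F, F, F, F, F] [F, F, F, F] mult4_\<Phi>"
  unfolding mult4_def mult4_\<Phi>_def
  by (rule cellI, (rule rep_intros structure_cells mult_cells(4) \<Phi>_mult_cells(1) cross3_cells(2)[of F \<tau>] | simp)+)+

text \<open>Combines both comonadic laws. It is needed because the cocycle condition crosses two
  strands and then doubles both, while \<open>mult4\<close> crosses strands that have been doubled
  before.\<close>

lemma \<Delta>_\<Delta>_\<tau>:
  "(F1 \<star> \<tau> \<star> F1) \<cdot> (\<tau> \<star> \<tau>) \<cdot> (F1 \<star> \<tau> \<star> F1) \<cdot> (\<Delta> \<star> \<Delta>) = (\<Delta> \<star> \<Delta>) \<cdot> \<tau>"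
proof -
  have left: "(F1 \<star> \<tau>) \<cdot> (\<tau> \<star> F1) \<cdot> (F1 \<star> \<Delta>) = (\<Delta> \<star> F1) \<cdot> \<tau>"
    and right: "(\<tau> \<star> F1) \<cdot> (F1 \<star> \<tau>) \<cdot> (\<Delta> \<star> F1) = (F1 \<star> \<Delta>) \<cdot> \<tau>"
    using \<tau>_left_comonadic \<tau>_right_comonadic by (simp_all add: left_comonadic_def right_comonadic_def)
  have "(F1 \<star> \<tau> \<star> F1) \<cdot> (\<tau> \<star> \<tau>) \<cdot> (F1 \<star> \<tau> \<star> F1) \<cdot> (\<Delta> \<star> \<Delta>) =
    (F1 \<star> \<tau> \<star> F1) \<cdot> (\<tau> \<star> F2) \<cdot> (F1 \<star> ((F1 \<star> \<tau>) \<cdot> (\<tau> \<star> F1) \<cdot> (F1 \<star> \<Delta>))) \<cdot> (\<Delta> \<star> F1)"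
    by (rule diagram_eqI, (rule rep_intros structure_cells | simp)+)
  also have "\<dots> = (((F1 \<star> \<tau>) \<cdot> (\<tau> \<star> F1) \<cdot> (F1 \<star> \<Delta>)) \<star> F1) \<cdot> (F1 \<star> \<tau>) \<cdot> (\<Delta> \<star> F1)"
    by (subst left) (rule diagram_eqI, (rule rep_intros structure_cells | simp)+)
  also have "\<dots> = (\<Delta> \<star> F2) \<cdot> ((\<tau> \<star> F1) \<cdot> (F1 \<star> \<tau>) \<cdot> (\<Delta> \<star> F1))"
    by (subst left) (rule diagram_eqI, (rule rep_intros structure_cells | simp)+)
  also have "\<dots> = (\<Delta> \<star> \<Delta>) \<cdot> \<tau>"
    by (subst right) (rule diagram_eqI, (rule rep_intros structure_cells | simp)+)
  finally show ?thesis .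
qed

text \<open>The 3-cocycle condition in terms of crossed products. The comonadic laws move each
  \<Delta> to the side of the crossings where the axiom has it.\<close>

lemma mult4_\<Phi>_cocycle:
  "mult4_\<Phi> \<cdot> (((F1 \<star> \<Delta> \<star> F1) \<cdot> \<Phi>) \<star> \<Phi> \<star> \<eta>) =
   mult4 \<cdot> (((F2 \<star> \<Delta>) \<cdot> \<Phi>) \<star> ((\<Delta> \<star> F2) \<cdot> \<Phi>))"
proof -
  have left: "(F1 \<star> \<tau>) \<cdot> (\<tau> \<star> F1) \<cdot> (F1 \<star> \<Delta>) = (\<Delta> \<star> F1) \<cdot> \<tau>"
    and right: "(\<tau> \<star> F1) \<cdot> (F1 \<star> \<tau>) \<cdot> (\<Delta> \<star> F1) = (F1 \<star> \<Delta>) \<cdot> \<tau>"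
    and unit: "\<mu> \<cdot> (F1 \<star> \<eta>) = F1"
    using \<tau>_left_comonadic \<tau>_right_comonadic is_monad
    by (simp_all add: left_comonadic_def right_comonadic_def monad_def)
  note cells = structure_cells mult_cells(4) \<Phi>_mult_cells(1)
  have "mult4_\<Phi> \<cdot> (((F1 \<star> \<Delta> \<star> F1) \<cdot> \<Phi>) \<star> \<Phi> \<star> \<eta>) =
    (\<mu> \<star> \<Phi>_mult) \<cdot> (F1 \<star> ((\<tau> \<star> F1) \<cdot> (F1 \<star> \<tau>) \<cdot> (\<Delta> \<star> F1)) \<star> F4) \<cdot> (F2 \<star> \<tau> \<star> F3) \<cdot> (\<Phi> \<star> \<Phi> \<star> \<eta>)"
    unfolding mult4_\<Phi>_def cross3_def cross2_def
    by (rule diagram_eqI, (rule rep_intros cells | simp)+)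
  \<comment> \<open>The first leg of the second \<Phi> crosses both outputs of the middle \<Delta>;
    by \<open>right\<close> it may cross the undivided strand.\<close>
  also have "\<dots> = (F1 \<star> mult3) \<cdot> (F1 \<star> \<mu> \<star> \<mu> \<star> \<mu> \<star> F3) \<cdot> (F2 \<star> \<tau> \<star> F2 \<star> F4) \<cdot>
      (F3 \<star> ((F1 \<star> \<tau>) \<cdot> (\<tau> \<star> F1) \<cdot> (F1 \<star> \<Delta>)) \<star> F4) \<cdot> (F1 \<star> \<Phi> \<star> F1 \<star> F4) \<cdot> (\<mu> \<star> F1 \<star> F4) \<cdot>
      (F1 \<star> \<tau> \<star> F4) \<cdot> (F2 \<star> \<tau> \<star> F3) \<cdot> (\<Phi> \<star> \<Phi> \<star> \<eta>)"
    unfolding right \<Phi>_mult_def unfolding mult3_def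
    by (rule diagram_eqI, (rule rep_intros cells | simp)+)
  \<comment> \<open>Likewise the third leg of the \<Phi> inserted by \<open>\<Phi>_mult\<close>
    crosses both outputs of that \<Delta>; \<open>left\<close> turns this into a single
    crossing.\<close>
  also have "\<dots> = (F1 \<star> \<mu> \<star> \<mu> \<star> (\<mu> \<cdot> (F1 \<star> \<eta>))) \<cdot> (F2 \<star> \<tau> \<star> \<tau>) \<cdot> (F3 \<star> \<tau> \<star> F1) \<cdot>
      (F1 \<star> \<mu> \<star> \<mu> \<star> \<mu> \<star> F2) \<cdot> (F2 \<star> \<tau> \<star> F1 \<star> F4) \<cdot> (F3 \<star> ((\<Delta> \<star> F1) \<cdot> \<tau>) \<star> F3) \<cdot>
      (F1 \<star> \<Phi> \<star> F4) \<cdot> (\<mu> \<star> F4) \<cdot> (F1 \<star> \<tau> \<star> F3) \<cdot> (F2 \<star> \<tau> \<star> F2) \<cdot> (\<Phi> \<star> \<Phi>)"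
    unfolding left mult3_def
    by (rule diagram_eqI, (rule rep_intros cells | simp)+)
  \<comment> \<open>The unit in the fourth leg of the right factor disappears, and what remains is
    literally the left-hand side of the axiom.\<close>
  also have "\<dots> =
     (F1 \<star> \<mu> \<star> \<mu> \<star> F1) \<cdot> (F2 \<star> \<tau> \<star> F2) \<cdot> (F1 \<star> \<mu> \<star> \<mu> \<star> F1 \<star> \<tau>) \<cdot>
     (F2 \<star> \<tau> \<star> F1 \<star> \<tau> \<star> F1) \<cdot> (F3 \<star> \<Delta> \<star> \<mu> \<star> F2) \<cdot> (F3 \<star> \<tau> \<star> F3) \<cdot>
     (F1 \<star> \<Phi> \<star> F4) \<cdot> (\<mu> \<star> F4) \<cdot> (F1 \<star> \<tau> \<star> F3) \<cdot> (F2 \<star> \<tau> \<star> F2) \<cdot> (\<Phi> \<star> \<Phi>)"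
    unfolding unit
    by (rule diagram_eqI, (rule rep_intros cells | simp)+)
  also have "\<dots> = (\<mu> \<star> \<mu> \<star> \<mu> \<star> \<mu>) \<cdot> (F1 \<star> \<tau> \<star> F2 \<star> \<tau> \<star> F1) \<cdot>
       (F2 \<star> \<Delta> \<star> \<Delta> \<star> F2) \<cdot> (F2 \<star> \<tau> \<star> F2) \<cdot> (\<Phi> \<star> \<Phi>)"
    using \<Phi>_cocycle by (simp add: cocycle3_def)
  also have "\<dots> = (\<mu> \<star> \<mu> \<star> \<mu> \<star> \<mu>) \<cdot> (F1 \<star> \<tau> \<star> F2 \<star> \<tau> \<star> F1) \<cdot>
       (F2 \<star> ((\<Delta> \<star> \<Delta>) \<cdot> \<tau>) \<star> F2) \<cdot> (\<Phi> \<star> \<Phi>)"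
    by (rule diagram_eqI, (rule rep_intros cells | simp)+)
  also have "\<dots> = mult4 \<cdot> (((F2 \<star> \<Delta>) \<cdot> \<Phi>) \<star> ((\<Delta> \<star> F2) \<cdot> \<Phi>))"
    unfolding \<Delta>_\<Delta>_\<tau>[symmetric] mult4_def cross3_def cross2_def mult3_def
    by (rule diagram_eqI, (rule rep_intros cells | simp)+)
  finally show ?thesis .
qed

text \<open>\<Phi> slides past \<open>W\<close> by the object axiom \<open>cr_\<Phi>\<close>; hence
  so does left multiplication by \<Phi>, and with it the product \<open>\<Phi>_mult\<close>.\<close>

lemma cross3_\<Phi>_mult:
  assumes w [simp]: "w \<in> Ob tambara_category"
  shows "cross3 (cr w) \<cdot> (\<Phi>_mult \<star> \<iota> (ob w)) =
   (\<iota> (ob w) \<star> \<Phi>_mult) \<cdot> (cross3 (cr w) \<star> F3) \<cdot> (F3 \<star> cross3 (cr w))"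
proof -
  have \<Phi>: "cell [] [F \<diamond> F \<diamond> F] \<Phi>" using structure_cells by (simp add: cell_def)
  have c: "cell [F \<diamond> F \<diamond> F] [F \<diamond> F \<diamond> F] (mult3 \<cdot> (\<Phi> \<star> F3))"
    by (rule cellI, (rule rep_intros structure_cells mult_cells(4) | simp)+)
  have "(\<iota> (ob w) \<star> \<Phi>) \<cdot> \<iota> (ob w) = \<iota> (ob w) \<star> \<Phi>"
    by (rule diagram_eqI, (rule rep_intros structure_cells | simp)+)
  then have "cross3 (cr w) \<cdot> (\<Phi> \<star> \<iota> (ob w)) = \<iota> (ob w) \<star> \<Phi>"
    using cr_\<Phi>[OF w] by simp
  then have "cross3 (cr w) \<cdot> ((mult3 \<cdot> (\<Phi> \<star> F3)) \<star> \<iota> (ob w)) = (\<iota> (ob w) \<star> (mult3 \<cdot> (\<Phi> \<star> F3))) \<cdot> cross3 (cr w)"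
    by (intro cross_mult_element) (use tambara_cells[OF w] mult_cells \<Phi> cross3_mult[OF w] in simp_all)
  then show ?thesis
    unfolding \<Phi>_mult_def
    by (intro cross_absorb) (use tambara_cells[OF w] mult_cells c cross3_mult[OF w] in simp_all)
qed

text \<open>The constraint acts as \<Phi>, so three successive actions are merged. \<Phi> is joined
  to the outer action before the inner one, as the bracketing of \<open>\<Phi>_mult\<close>
  prescribes.\<close>

lemma assoc_act3_act3:
  assumes [simp]: "x \<in> Ob tambara_category" "y \<in> Ob tambara_category" "z \<in> Ob tambara_category"
  shows "tambara_assoc x y z \<cdot> act3 x y z \<cdot> (F3 \<star> act3 x y z) =
   act3 x y z \<cdot> (\<Phi>_mult \<star> \<iota> (ob x \<diamond> ob y \<diamond> ob z))"
proof -
  let ?I = "\<iota> (ob x \<diamond> ob y \<diamond> ob z)"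
  note cells = structure_cells act3_cells(1)[OF assms] mult_cells(4)
  have "tambara_assoc x y z \<cdot> act3 x y z \<cdot> (F3 \<star> act3 x y z) =
    (act3 x y z \<cdot> (F3 \<star> act3 x y z)) \<cdot> (\<Phi> \<star> F3 \<star> act3 x y z)"
    unfolding assoc_eq[OF assms] by (rule diagram_eqI, (rule rep_intros cells | simp)+)
  also have "\<dots> = (act3 x y z \<cdot> (F3 \<star> act3 x y z)) \<cdot> ((mult3 \<cdot> (\<Phi> \<star> F3)) \<star> F3 \<star> ?I)"
    by (subst act3_mult[OF assms]) (rule diagram_eqI, (rule rep_intros cells | simp)+)
  also have "\<dots> = act3 x y z \<cdot> (\<Phi>_mult \<star> ?I)"
    unfolding act3_mult[OF assms] \<Phi>_mult_def by (rule diagram_eqI, (rule rep_intros cells | simp)+)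
  finally show ?thesis .
qed

section \<open>The constraints of the pentagon on four modules\<close>

context
  fixes w x y z
  assumes w [simp]: "w \<in> Ob tambara_category" and x [simp]: "x \<in> Ob tambara_category"
    and y [simp]: "y \<in> Ob tambara_category" and z [simp]: "z \<in> Ob tambara_category"
begin

lemmas cells4 = structure_cells tambara_cells[OF w] tambara_cells[OF x] tambara_cells[OF y] tambara_cells[OF z]

abbreviation (input) "I4 \<equiv> \<iota> (ob w \<diamond> ob x \<diamond> ob y \<diamond> ob z)"

lemma act4_cell: "cell [F, F, F, F, ob w, ob x, ob y, ob z] [ob w, ob x, ob y, ob z] (act4 w x y z)"
  unfolding act4_def
  by (rule cellI, rule rep_cell, rule cell_smash[where G = "F \<diamond> F \<diamond> F"];
      use tambara_cells[OF w] act3_cells[OF x y z] in simp)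

lemma act4_mult:
  "act4 w x y z \<cdot> (F4 \<star> act4 w x y z) = act4 w x y z \<cdot> (mult4 \<star> I4)"
  unfolding act4_def mult4_def
  by (rule smash_mult)
    (use cells4 act3_cells[OF x y z] cross3_cells[of F \<tau>] mult_cells cross3_mult[OF w] cross3_ac[OF w]
      ac_assoc[OF w] act3_mult[OF x y z] in simp_all)

text \<open>The instance of \<open>smash_assoc\<close> with the constraint of the last three modules
  as \<omega> and \<open>\<Phi>_mult\<close> as \<open>m\<close>.\<close>

lemma assoc_act4_act4:
  "(\<iota> (ob w) \<star> tambara_assoc x y z) \<cdot> act4 w x y z \<cdot> (F4 \<star> act4 w x y z) =
   act4 w x y z \<cdot> (mult4_\<Phi> \<star> I4)"
  unfolding act4_def mult4_\<Phi>_def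
  by (rule smash_assoc)
    (use cells4 act3_cells[OF x y z] assoc_cells[OF x y z] cross3_cells[of F \<tau>] \<Phi>_mult_cells cross3_\<Phi>_mult[OF w]
      cross3_ac[OF w] ac_assoc[OF w] assoc_act3_act3[OF x y z] in simp_all)

lemma assoc_tensor_right:
  "tambara_assoc w x (tambara_tensor y z) = act4 w x y z \<cdot> (((F2 \<star> \<Delta>) \<cdot> \<Phi>) \<star> I4)"
proof -
  note cells = cells4 act2_cells(1)[OF y z]
  have "tambara_assoc w x (tambara_tensor y z) =
    (ac w \<star> ac x \<star> act2 y z) \<cdot>
    (F1 \<star> \<iota> (ob w) \<star> F1 \<star> ((\<iota> (ob x) \<star> \<Delta>) \<cdot> cr x) \<star> \<iota> (ob y \<diamond> ob z)) \<cdot>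
    (F1 \<star> ((cr w \<star> F1) \<cdot> (F1 \<star> cr w)) \<star> \<iota> (ob x \<diamond> ob y \<diamond> ob z)) \<cdot> (\<Phi> \<star> I4)"
    unfolding tambara_assoc_proj ac_tensor[OF y z] unfolding tensor_proj
    by (rule diagram_eqI, (rule rep_intros cells | simp)+)
  \<comment> \<open>The third leg of \<Phi> crosses \<open>W\<close> and \<open>X\<close> before it
    is doubled. \<Delta> is moved back past \<open>X\<close> here and past \<open>W\<close> in the
    next step.\<close>
  also have "\<dots> = (ac w \<star> ac x \<star> act2 y z) \<cdot>
    (F1 \<star> \<iota> (ob w) \<star> F1 \<star> cross2 (cr x) \<star> \<iota> (ob y \<diamond> ob z)) \<cdot>
    (F1 \<star> cr w \<star> F2 \<star> \<iota> (ob x \<diamond> ob y \<diamond> ob z)) \<cdot>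
    (F2 \<star> ((\<iota> (ob w) \<star> \<Delta>) \<cdot> cr w) \<star> \<iota> (ob x \<diamond> ob y \<diamond> ob z)) \<cdot> (\<Phi> \<star> I4)"
    by (subst cr_\<Delta>[OF x]) (rule diagram_eqI, (rule rep_intros cells | simp)+)
  also have "\<dots> = act4 w x y z \<cdot> (((F2 \<star> \<Delta>) \<cdot> \<Phi>) \<star> I4)"
    unfolding cr_\<Delta>[OF w] act4_def act3_def smash_def cross3_def cross2_def
    by (rule diagram_eqI, (rule rep_intros cells | simp)+)
  finally show ?thesis .
qed

lemma assoc_tensor_left:
  "tambara_assoc (tambara_tensor w x) y z = act4 w x y z \<cdot> (((\<Delta> \<star> F2) \<cdot> \<Phi>) \<star> I4)"
  unfolding tambara_assoc_proj tensor_proj act4_def act3_def act2_def smash_def cross3_def cross2_def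
  by (rule diagram_eqI, (rule rep_intros cells4 | simp)+)

text \<open>The middle leg crosses only \<open>W\<close> before it is doubled, so a single use of
  \<open>cr_\<Delta>\<close> brings \<Delta> next to \<Phi>.\<close>

lemma assoc_tensor_middle:
  "tambara_assoc w (tambara_tensor x y) z = act4 w x y z \<cdot> (((F1 \<star> \<Delta> \<star> F1) \<cdot> \<Phi>) \<star> I4)"
proof -
  note cells = cells4 act2_cells(1)[OF x y]
  have "tambara_assoc w (tambara_tensor x y) z =
    (ac w \<star> act2 x y \<star> ac z) \<cdot>
    (F1 \<star> \<iota> (ob w) \<star> F2 \<star> cr (tambara_tensor x y) \<star> \<iota> (ob z)) \<cdot>
    (F1 \<star> ((\<iota> (ob w) \<star> \<Delta>) \<cdot> cr w) \<star> F1 \<star> \<iota> (ob x \<diamond> ob y \<diamond> ob z)) \<cdot>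
    (F2 \<star> cr w \<star> \<iota> (ob x \<diamond> ob y \<diamond> ob z)) \<cdot> (\<Phi> \<star> I4)"
    unfolding tambara_assoc_proj ac_tensor[OF x y] unfolding tensor_proj
    by (rule diagram_eqI, (rule rep_intros cells | simp)+)
  also have "\<dots> = act4 w x y z \<cdot> (((F1 \<star> \<Delta> \<star> F1) \<cdot> \<Phi>) \<star> I4)"
    unfolding cr_\<Delta>[OF w] tensor_proj act4_def act3_def act2_def smash_def cross3_def cross2_def
    by (rule diagram_eqI, (rule rep_intros cells | simp)+)
  finally show ?thesis .
qed

text \<open>The strand created by \<eta> is followed from left to right: it passes \<open>W\<close>,
  \<open>X\<close> and \<open>Y\<close> by \<open>cross_unit\<close> and finally acts trivially on
  \<open>Z\<close>.\<close>

lemma assoc_whisker: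
  "tambara_assoc w x y \<star> \<iota> (ob z) = act4 w x y z \<cdot> ((\<Phi> \<star> \<eta>) \<star> I4)"
proof -
  let ?W = "\<iota> (ob w)" and ?X = "\<iota> (ob x)" and ?Y = "\<iota> (ob y)" and ?Z = "\<iota> (ob z)"
  have "act4 w x y z \<cdot> ((\<Phi> \<star> \<eta>) \<star> I4) =
    (ac w \<star> ac x \<star> ac y \<star> ac z) \<cdot> (F1 \<star> ?W \<star> F1 \<star> ?X \<star> F1 \<star> cr y \<star> ?Z) \<cdot>
    (F1 \<star> ?W \<star> F1 \<star> cross2 (cr x) \<star> ?Y \<star> ?Z) \<cdot>
    (F1 \<star> ((cr w \<star> F2) \<cdot> (F1 \<star> cr w \<star> F1)) \<star> ?X \<star> ?Y \<star> ?Z) \<cdot>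
    (\<Phi> \<star> (cr w \<cdot> (\<eta> \<star> ?W)) \<star> ?X \<star> ?Y \<star> ?Z)"
    unfolding act4_def act3_def act2_def smash_def cross3_def cross2_def
    by (rule diagram_eqI, (rule rep_intros cells4 | simp)+)
  also have "\<dots> =
    (ac w \<star> ac x \<star> ac y \<star> ac z) \<cdot> (F1 \<star> ?W \<star> F1 \<star> ?X \<star> F1 \<star> cr y \<star> ?Z) \<cdot>
    (F1 \<star> ?W \<star> F1 \<star> cr x \<star> F1 \<star> ?Y \<star> ?Z) \<cdot>
    (F1 \<star> ?W \<star> F2 \<star> (cr x \<cdot> (\<eta> \<star> ?X)) \<star> ?Y \<star> ?Z) \<cdot>
    (F1 \<star> ((cr w \<star> F1) \<cdot> (F1 \<star> cr w)) \<star> ?X \<star> ?Y \<star> ?Z) \<cdot> (\<Phi> \<star> ?W \<star> ?X \<star> ?Y \<star> ?Z)"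
    unfolding cross_unit[OF w] cross2_def
    by (rule diagram_eqI, (rule rep_intros cells4 | simp)+)
  also have "\<dots> =
    (ac w \<star> ac x \<star> ac y \<star> ac z) \<cdot> (F1 \<star> ?W \<star> F1 \<star> ?X \<star> F1 \<star> (cr y \<cdot> (\<eta> \<star> ?Y)) \<star> ?Z) \<cdot>
    (F1 \<star> ?W \<star> F1 \<star> cr x \<star> ?Y \<star> ?Z) \<cdot>
    (F1 \<star> ((cr w \<star> F1) \<cdot> (F1 \<star> cr w)) \<star> ?X \<star> ?Y \<star> ?Z) \<cdot> (\<Phi> \<star> ?W \<star> ?X \<star> ?Y \<star> ?Z)"
    unfolding cross_unit[OF x]
    by (rule diagram_eqI, (rule rep_intros cells4 | simp)+)
  also have "\<dots> =
    (ac w \<star> ac x \<star> ac y \<star> (ac z \<cdot> (\<eta> \<star> ?Z))) \<cdot>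
    (F1 \<star> ?W \<star> F1 \<star> cr x \<star> ?Y \<star> ?Z) \<cdot>
    (F1 \<star> ((cr w \<star> F1) \<cdot> (F1 \<star> cr w)) \<star> ?X \<star> ?Y \<star> ?Z) \<cdot> (\<Phi> \<star> ?W \<star> ?X \<star> ?Y \<star> ?Z)"
    unfolding cross_unit[OF y]
    by (rule diagram_eqI, (rule rep_intros cells4 | simp)+)
  also have "\<dots> = tambara_assoc w x y \<star> \<iota> (ob z)"
    unfolding ac_unit[OF z] tambara_assoc_proj
    by (rule diagram_eqI, (rule rep_intros cells4 | simp)+)
  finally show ?thesis by simp
qed

lemma assoc_pentagon:
  "tambara_assoc w x (tambara_tensor y z) \<cdot> tambara_assoc (tambara_tensor w x) y z =
   (\<iota> (ob w) \<star> tambara_assoc x y z) \<cdot> tambara_assoc w (tambara_tensor x y) z \<cdot>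
   (tambara_assoc w x y \<star> \<iota> (ob z))"
proof -
  note cells = structure_cells act4_cell mult4_cells assoc_cells(1)[OF x y z]
  have "(\<iota> (ob w) \<star> tambara_assoc x y z) \<cdot> tambara_assoc w (tambara_tensor x y) z \<cdot>
      (tambara_assoc w x y \<star> \<iota> (ob z)) =
    ((\<iota> (ob w) \<star> tambara_assoc x y z) \<cdot> act4 w x y z \<cdot> (F4 \<star> act4 w x y z)) \<cdot>
    (((F1 \<star> \<Delta> \<star> F1) \<cdot> \<Phi>) \<star> (\<Phi> \<star> \<eta>) \<star> I4)"
    unfolding assoc_tensor_middle assoc_whisker
    by (rule diagram_eqI, (rule rep_intros cells | simp)+)
  \<comment> \<open>The whiskered constraint and the two actions are absorbed together into one
    twisted product of elements, to which the cocycle identity applies next.\<close>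
  also have "\<dots> = act4 w x y z \<cdot> ((mult4_\<Phi> \<cdot> (((F1 \<star> \<Delta> \<star> F1) \<cdot> \<Phi>) \<star> \<Phi> \<star> \<eta>)) \<star> I4)"
    unfolding assoc_act4_act4
    by (rule diagram_eqI, (rule rep_intros cells | simp)+)
  also have "\<dots> = (act4 w x y z \<cdot> (mult4 \<star> I4)) \<cdot> (((F2 \<star> \<Delta>) \<cdot> \<Phi>) \<star> ((\<Delta> \<star> F2) \<cdot> \<Phi>) \<star> I4)"
    unfolding mult4_\<Phi>_cocycle
    by (rule diagram_eqI, (rule rep_intros cells | simp)+)
  also have "\<dots> = tambara_assoc w x (tambara_tensor y z) \<cdot> tambara_assoc (tambara_tensor w x) y z"
    unfolding act4_mult[symmetric] assoc_tensor_right assoc_tensor_left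
    by (rule diagram_eqI, (rule rep_intros cells | simp)+)
  finally show ?thesis by simp
qed

end

section \<open>The monoidal category\<close>

lemma tambara_simps [simp]:
  "Id tambara_category x = \<iota> (ob x)" "Comp tambara_category = VComp K"
  by (cases x) (simp_all add: tambara_category_def)

lemma Id_in_Hom:
  assumes x [simp]: "x \<in> Ob tambara_category"
  shows "\<iota> (ob x) \<in> Hom tambara_category x x"
  unfolding Hom_tambara_iff[OF x x]
  by (intro conjI; (rule cellI diagram_eqI), (rule rep_intros tambara_cells[OF x] | simp)+)

lemma Comp_in_Hom:
  assumes x [simp]: "x \<in> Ob tambara_category" and y [simp]: "y \<in> Ob tambara_category" and z [simp]: "z \<in> Ob tambara_category"
    and g: "g \<in> Hom tambara_category y z" and f: "f \<in> Hom tambara_category x y"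
  shows "g \<cdot> f \<in> Hom tambara_category x z"
proof -
  note cells = tambara_cells[OF x] tambara_cells[OF y] tambara_cells[OF z] Hom_cell[OF x y f] Hom_cell[OF y z g]
  have "((g \<cdot> f) \<star> F1) \<cdot> cr x = (g \<star> F1) \<cdot> (f \<star> F1) \<cdot> cr x"
    by (rule diagram_eqI, (rule rep_intros cells | simp)+)
  also have "\<dots> = ((g \<star> F1) \<cdot> cr y) \<cdot> (F1 \<star> f)"
    unfolding Hom_cr[OF x y f] by (rule diagram_eqI, (rule rep_intros cells | simp)+)
  also have "\<dots> = cr z \<cdot> (F1 \<star> (g \<cdot> f))"
    unfolding Hom_cr[OF y z g] by (rule diagram_eqI, (rule rep_intros cells | simp)+)
  finally have cross: "((g \<cdot> f) \<star> F1) \<cdot> cr x = cr z \<cdot> (F1 \<star> (g \<cdot> f))" .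
  have "(g \<cdot> f) \<cdot> ac x = g \<cdot> f \<cdot> ac x"
    by (rule diagram_eqI, (rule rep_intros cells | simp)+)
  also have "\<dots> = (g \<cdot> ac y) \<cdot> (F1 \<star> f)"
    unfolding Hom_ac[OF x y f] by (rule diagram_eqI, (rule rep_intros cells | simp)+)
  also have "\<dots> = ac z \<cdot> (F1 \<star> (g \<cdot> f))"
    unfolding Hom_ac[OF y z g] by (rule diagram_eqI, (rule rep_intros cells | simp)+)
  finally have "(g \<cdot> f) \<cdot> ac x = ac z \<cdot> (F1 \<star> (g \<cdot> f))" .
  with cross show ?thesis
    unfolding Hom_tambara_iff[OF x z] using cell_VComp cells by blast
qed

lemma category_tambara: "category tambara_category"
proof
  fix w x y z h g f
  assume w [simp]: "w \<in> Ob tambara_category" and x [simp]: "x \<in> Ob tambara_category"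
  show "Id tambara_category x \<in> Hom tambara_category x x"
    using Id_in_Hom[OF x] by simp
  assume f: "f \<in> Hom tambara_category w x"
  note cf = Hom_cell[OF w x f]
  show "Id tambara_category x \<odot>\<^bsub>tambara_category\<^esub> f = f" "f \<odot>\<^bsub>tambara_category\<^esub> Id tambara_category w = f"
    using cell_Id_left[OF cf] cell_Id_right[OF cf] w x by simp_all
  assume y [simp]: "y \<in> Ob tambara_category" and g: "g \<in> Hom tambara_category x y"
  show "g \<odot>\<^bsub>tambara_category\<^esub> f \<in> Hom tambara_category w y"
    using Comp_in_Hom[OF w x y g f] by simp
  assume z [simp]: "z \<in> Ob tambara_category" and h: "h \<in> Hom tambara_category y z"
  show "(h \<odot>\<^bsub>tambara_category\<^esub> g) \<odot>\<^bsub>tambara_category\<^esub> f = h \<odot>\<^bsub>tambara_category\<^esub> g \<odot>\<^bsub>tambara_category\<^esub> f"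
    using cell_VComp_assoc[OF Hom_cell[OF y z h] Hom_cell[OF x y g] cf] by simp
qed

text \<open>A two-sided inverse 2-cell of a morphism is itself a morphism:
  \<open>f \<cdot> g\<close> is inserted on the far side of the crossing or action, \<open>f\<close>
  is moved through, and \<open>g \<cdot> f\<close> cancels.\<close>

lemma isosI:
  assumes x [simp]: "x \<in> Ob tambara_category" and y [simp]: "y \<in> Ob tambara_category"
    and f: "f \<in> Hom tambara_category x y" and g: "cell [ob y] [ob x] g"
    and gf: "g \<cdot> f = \<iota> (ob x)" and fg: "f \<cdot> g = \<iota> (ob y)"
  shows "f \<in> isos tambara_category x y"
proof -
  note cells = tambara_cells[OF x] tambara_cells[OF y] Hom_cell[OF x y f] g
  have "(g \<star> F1) \<cdot> cr y = (g \<star> F1) \<cdot> cr y \<cdot> (F1 \<star> (f \<cdot> g))"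
    unfolding fg by (rule diagram_eqI, (rule rep_intros cells | simp)+)
  also have "\<dots> = (g \<star> F1) \<cdot> (cr y \<cdot> (F1 \<star> f)) \<cdot> (F1 \<star> g)"
    by (rule diagram_eqI, (rule rep_intros cells | simp)+)
  also have "\<dots> = ((g \<cdot> f) \<star> F1) \<cdot> cr x \<cdot> (F1 \<star> g)"
    unfolding Hom_cr[OF x y f, symmetric] by (rule diagram_eqI, (rule rep_intros cells | simp)+)
  also have "\<dots> = cr x \<cdot> (F1 \<star> g)"
    unfolding gf by (rule diagram_eqI, (rule rep_intros cells | simp)+)
  finally have cross: "(g \<star> F1) \<cdot> cr y = cr x \<cdot> (F1 \<star> g)" .
  have "g \<cdot> ac y = g \<cdot> ac y \<cdot> (F1 \<star> (f \<cdot> g))"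
    unfolding fg by (rule diagram_eqI, (rule rep_intros cells | simp)+)
  also have "\<dots> = g \<cdot> (ac y \<cdot> (F1 \<star> f)) \<cdot> (F1 \<star> g)"
    by (rule diagram_eqI, (rule rep_intros cells | simp)+)
  also have "\<dots> = (g \<cdot> f) \<cdot> ac x \<cdot> (F1 \<star> g)"
    unfolding Hom_ac[OF x y f, symmetric] by (rule diagram_eqI, (rule rep_intros cells | simp)+)
  also have "\<dots> = ac x \<cdot> (F1 \<star> g)"
    unfolding gf by (rule diagram_eqI, (rule rep_intros cells | simp)+)
  finally have "g \<in> Hom tambara_category y x"
    using cross g Hom_tambara_iff[OF y x] by simp
  with f gf fg show ?thesis by (auto simp: isos_def)
qed

lemma Id_in_isos:
  assumes x [simp]: "x \<in> Ob tambara_category"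
  shows "\<iota> (ob x) \<in> isos tambara_category x x"
proof -
  have "\<iota> (ob x) \<cdot> \<iota> (ob x) = \<iota> (ob x)"
    by (rule diagram_eqI, (rule rep_intros | simp)+)
  then show ?thesis using Id_in_Hom[OF x] by (auto simp: isos_def)
qed

section \<open>The unit object and the triangle\<close>

lemma unit_proj [simp]:
  "ob tambara_unit = Id1 K A" "cr tambara_unit = F1" "ac tambara_unit = \<epsilon>"
  by (simp_all add: tambara_unit_def)

text \<open>For the identity 1-cell the object equations reduce to interchange. The module laws for
  \<epsilon> are \<open>\<epsilon>_\<mu>\<close> and \<open>\<epsilon>_\<eta>\<close>, and the
  Tambara condition is the counit half of left comonadicity.\<close>

lemma unit_closed: "tambara_unit \<in> Ob tambara_category"
proof -
  note comonadic = \<tau>_left_comonadic[unfolded left_comonadic_def]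
  have c: "cell [F, Id1 K A] [Id1 K A, F] F1" "cell [F, Id1 K A] [Id1 K A] \<epsilon>"
    using Id2_closed structure_cells by (simp_all add: cell_def)
  have "qb_object (Id1 K A) F1"
    unfolding qb_object_iff cross3_def cross2_def
    by (intro conjI c; (rule diagram_eqI)?, (rule rep_intros structure_cells | simp)+)
  moreover have "\<epsilon> \<cdot> (\<mu> \<star> \<iota> (Id1 K A)) = \<epsilon> \<cdot> (F1 \<star> \<epsilon>)"
  proof -
    have "\<epsilon> \<cdot> (\<mu> \<star> \<iota> (Id1 K A)) = \<epsilon> \<cdot> \<mu>"
      by (rule diagram_eqI, (rule rep_intros structure_cells | simp)+)
    also have "\<dots> = \<epsilon> \<cdot> (F1 \<star> \<epsilon>)"
      unfolding \<epsilon>_\<mu> by (rule diagram_eqI, (rule rep_intros structure_cells | simp)+)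
    finally show ?thesis .
  qed
  moreover have "\<epsilon> \<cdot> (\<eta> \<star> \<iota> (Id1 K A)) = \<iota> (Id1 K A)"
    by (rule trans[OF _ \<epsilon>_\<eta>], rule diagram_eqI, (rule rep_intros structure_cells | simp)+)
  moreover have "F1 \<cdot> (F1 \<star> \<epsilon>) = (\<epsilon> \<star> F1) \<cdot> (F1 \<star> F1) \<cdot> (\<tau> \<star> \<iota> (Id1 K A))"
  proof -
    have "F1 \<cdot> (F1 \<star> \<epsilon>) = F1 \<star> \<epsilon>"
      by (rule diagram_eqI, (rule rep_intros structure_cells | simp)+)
    also have "\<dots> = (\<epsilon> \<star> F1) \<cdot> (F1 \<star> F1) \<cdot> (\<tau> \<star> \<iota> (Id1 K A))"
      unfolding conjunct2[OF comonadic, symmetric]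
      by (rule diagram_eqI, (rule rep_intros structure_cells | simp)+)
    finally show ?thesis .
  qed
  ultimately show ?thesis
    using c by (simp add: Ob_tambara_iff)
qed

text \<open>An equality of triples, not merely an isomorphism: this is what makes an identity a
  correctly typed unit constraint. The actions agree by the left counit law.\<close>

lemma tensor_unit_left:
  assumes x [simp]: "x \<in> Ob tambara_category"
  shows "tambara_tensor tambara_unit x = x"
proof -
  note cells = structure_cells tambara_cells[OF x]
  have "cr (tambara_tensor tambara_unit x) = cr x"
    unfolding tensor_proj unit_proj by (rule diagram_eqI, (rule rep_intros cells | simp)+)
  moreover have "ac (tambara_tensor tambara_unit x) = ac x \<cdot> (((\<epsilon> \<star> F1) \<cdot> \<Delta>) \<star> \<iota> (ob x))"
    unfolding tensor_proj unit_proj by (rule diagram_eqI, (rule rep_intros cells | simp)+)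
  moreover have "ac x \<cdot> (((\<epsilon> \<star> F1) \<cdot> \<Delta>) \<star> \<iota> (ob x)) = ac x"
    unfolding counit_left by (rule diagram_eqI, (rule rep_intros cells | simp)+)
  ultimately show ?thesis
    using x by (simp add: prod_eq_iff)
qed

text \<open>Here \<epsilon> is applied after the strand has crossed \<open>X\<close>, so
  \<open>cr_\<epsilon>\<close> is needed before the right counit law.\<close>

lemma tensor_unit_right:
  assumes x [simp]: "x \<in> Ob tambara_category"
  shows "tambara_tensor x tambara_unit = x"
proof -
  note cells = structure_cells tambara_cells[OF x]
  have "cr (tambara_tensor x tambara_unit) = cr x"
    unfolding tensor_proj unit_proj by (rule diagram_eqI, (rule rep_intros cells | simp)+)
  moreover have "ac (tambara_tensor x tambara_unit) = ac x"
  proof -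
    have "ac (tambara_tensor x tambara_unit) = ac x \<cdot> (F1 \<star> ((\<iota> (ob x) \<star> \<epsilon>) \<cdot> cr x)) \<cdot> (\<Delta> \<star> \<iota> (ob x))"
      unfolding tensor_proj unit_proj by (rule diagram_eqI, (rule rep_intros cells | simp)+)
    also have "\<dots> = ac x \<cdot> (((F1 \<star> \<epsilon>) \<cdot> \<Delta>) \<star> \<iota> (ob x))"
      unfolding cr_\<epsilon>[OF x] by (rule diagram_eqI, (rule rep_intros cells | simp)+)
    also have "\<dots> = ac x"
      unfolding counit_right by (rule diagram_eqI, (rule rep_intros cells | simp)+)
    finally show ?thesis .
  qed
  ultimately show ?thesis
    using x by (simp add: prod_eq_iff)
qed

text \<open>On the unit object the middle leg of \<Phi> acts by \<epsilon>, and normalization leaves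
  two units, which act trivially.\<close>

lemma assoc_triangle:
  assumes x [simp]: "x \<in> Ob tambara_category" and y [simp]: "y \<in> Ob tambara_category"
  shows "tambara_assoc x tambara_unit y = \<iota> (ob x \<diamond> ob y)"
proof -
  note cells = structure_cells tambara_cells[OF x] tambara_cells[OF y]
  have "tambara_assoc x tambara_unit y =
    (ac x \<star> ac y) \<cdot> (F1 \<star> ((\<iota> (ob x) \<star> \<epsilon>) \<cdot> cr x) \<star> F1 \<star> \<iota> (ob y)) \<cdot>
    (F2 \<star> cr x \<star> \<iota> (ob y)) \<cdot> (\<Phi> \<star> \<iota> (ob x) \<star> \<iota> (ob y))"
    unfolding tambara_assoc_proj unit_proj by (rule diagram_eqI, (rule rep_intros cells | simp)+)
  also have "\<dots> = act2 x y \<cdot> (((F1 \<star> \<epsilon> \<star> F1) \<cdot> \<Phi>) \<star> \<iota> (ob x \<diamond> ob y))"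
    unfolding cr_\<epsilon>[OF x] act2_def smash_def by (rule diagram_eqI, (rule rep_intros cells | simp)+)
  also have "\<dots> = \<iota> (ob x \<diamond> ob y)"
    unfolding \<Phi>_normalized by (rule act2_unit[OF x y])
  finally show ?thesis .
qed

end

section \<open>The constraint as an isomorphism of Tambara modules\<close>

context qb_zero_cell
begin

text \<open>Moving \<open>F\<close> past \<open>act3\<close> makes it cross the three legs of
  \<Phi>; by \<open>\<Phi>_\<tau>\<close> the result is \<Phi> created to the left of
  \<open>F\<close>.\<close>

lemma assoc_cross:
  assumes x [simp]: "x \<in> Ob tambara_category" and y [simp]: "y \<in> Ob tambara_category" and z [simp]: "z \<in> Ob tambara_category"
  shows "(tambara_assoc x y z \<star> F1) \<cdot> cr (tambara_tensor (tambara_tensor x y) z) =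
    cr (tambara_tensor x (tambara_tensor y z)) \<cdot> (F1 \<star> tambara_assoc x y z)"
proof -
  let ?I = "\<iota> (ob x \<diamond> ob y \<diamond> ob z)" and ?c = "cr (tambara_tensor x (tambara_tensor y z))"
  have c: "cell [F, ob x, ob y, ob z] [ob x, ob y, ob z, F] ?c"
    using tensor_cells(1)[OF x tensor_closed[OF y z]] x y z by (simp add: cell_def)
  note cells = structure_cells c act3_cells(1)[OF x y z] cocross_cells(3)
  have "?c \<cdot> (F1 \<star> tambara_assoc x y z) = (?c \<cdot> (F1 \<star> act3 x y z)) \<cdot> (F1 \<star> \<Phi> \<star> ?I)"
    unfolding assoc_eq[OF x y z] by (rule diagram_eqI, (rule rep_intros cells | simp)+)
  also have "\<dots> = (act3 x y z \<star> F1) \<cdot> (F3 \<star> ?c) \<cdot>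
      (((F2 \<star> \<tau>) \<cdot> (F1 \<star> \<tau> \<star> F1) \<cdot> (\<tau> \<star> F2) \<cdot> (F1 \<star> \<Phi>)) \<star> ?I)"
    unfolding act3_cross[OF x y z] unfolding cocross3_def cocross2_def
    by (rule diagram_eqI, (rule rep_intros cells | simp)+)
  also have "\<dots> = (tambara_assoc x y z \<star> F1) \<cdot> ?c"
    unfolding \<Phi>_\<tau>[symmetric] assoc_eq[OF x y z]
    by (rule diagram_eqI, (rule rep_intros cells | simp)+)
  finally show ?thesis
    unfolding cr_tensor_assoc[OF x y z] by simp
qed

lemma assoc_in_isos:
  assumes x [simp]: "x \<in> Ob tambara_category" and y [simp]: "y \<in> Ob tambara_category" and z [simp]: "z \<in> Ob tambara_category"
  shows "tambara_assoc x y z \<in>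
    isos tambara_category (tambara_tensor (tambara_tensor x y) z) (tambara_tensor x (tambara_tensor y z))"
proof -
  obtain \<Psi> where \<Psi>: "\<Psi> \<in> Cell2 K (Id1 K A) (F \<diamond> F \<diamond> F)"
    and inv: "convolution \<Phi> \<Psi> = \<eta> \<star> \<eta> \<star> \<eta>" "convolution \<Psi> \<Phi> = \<eta> \<star> \<eta> \<star> \<eta>"
    using \<Phi>_invertible by (auto simp: convolution_invertible_def)
  note l = tensor_closed[OF tensor_closed[OF x y] z] and r = tensor_closed[OF x tensor_closed[OF y z]]
  \<comment> \<open>The candidate inverse of \<alpha> is the action of the convolution inverse of
    \<Phi>.\<close>
  let ?g = "act3 x y z \<cdot> (\<Psi> \<star> \<iota> (ob x \<diamond> ob y \<diamond> ob z))"
  have "cell [] [F, F, F] \<Psi>" using \<Psi> by (simp add: cell_def)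
  then have g: "cell [ob x \<diamond> ob y \<diamond> ob z] [ob x \<diamond> ob y \<diamond> ob z] ?g"
    by - (rule cellI, (rule rep_intros act3_cells(1)[OF x y z] | assumption | simp)+)
  have "tambara_assoc x y z \<in> Hom tambara_category
      (tambara_tensor (tambara_tensor x y) z) (tambara_tensor x (tambara_tensor y z))"
    unfolding Hom_tambara_iff[OF l r]
    using assoc_cells(2)[OF x y z] assoc_cross[OF x y z] assoc_linear[OF x y z] x y z by simp
  then show ?thesis
    by (rule isosI[OF l r, where g = ?g])
      (use g assoc_inverse[OF x y z \<Phi>_cell \<Psi> inv(1)] assoc_inverse[OF x y z \<Psi> \<Phi>_cell inv(2)] x y z
       in \<open>simp_all add: assoc_eq\<close>)
qed

lemma monoidal_category_tambara:
  "monoidal_category tambara_category tambara_tensor (HComp K) tambara_unit tambara_assoc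
     (Id tambara_category) (Id tambara_category)"
proof (intro monoidal_category.intro monoidal_category_axioms.intro, unfold tambara_simps)
  show "category tambara_category" by (rule category_tambara)
next
  fix x y assume x [simp]: "x \<in> Ob tambara_category" and y [simp]: "y \<in> Ob tambara_category"
  show "tambara_tensor x y \<in> Ob tambara_category" using tensor_closed[OF x y] .
  show "\<iota> (ob x) \<star> \<iota> (ob y) = \<iota> (ob (tambara_tensor x y))"
    using x y by (simp add: endo_HComp_Id2)
  show "(\<iota> (ob x) \<star> \<iota> (ob y)) \<cdot> tambara_assoc x tambara_unit y = \<iota> (ob x) \<star> \<iota> (ob y)"
    unfolding assoc_triangle[OF x y] by (rule diagram_eqI, (rule rep_intros | simp)+)
next
  fix x x' y y' f g
  assume "x \<in> Ob tambara_category" "x' \<in> Ob tambara_category" "y \<in> Ob tambara_category" "y' \<in> Ob tambara_category"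
    "f \<in> Hom tambara_category x x'" "g \<in> Hom tambara_category y y'"
  then show "f \<star> g \<in> Hom tambara_category (tambara_tensor x y) (tambara_tensor x' y')"
    by (rule Hom_tensor)
next
  fix x x' x'' y y' y'' f f' g g'
  assume x [simp]: "x \<in> Ob tambara_category" "x' \<in> Ob tambara_category" "x'' \<in> Ob tambara_category"
    and y [simp]: "y \<in> Ob tambara_category" "y' \<in> Ob tambara_category" "y'' \<in> Ob tambara_category"
    and f: "f \<in> Hom tambara_category x x'" "f' \<in> Hom tambara_category x' x''"
    and g: "g \<in> Hom tambara_category y y'" "g' \<in> Hom tambara_category y' y''"
  show "(f' \<cdot> f) \<star> (g' \<cdot> g) = (f' \<star> g') \<cdot> (f \<star> g)"
    by (rule cell_interchange[OF Hom_cell[OF x(1,2) f(1)] Hom_cell[OF x(2,3) f(2)]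
          Hom_cell[OF y(1,2) g(1)] Hom_cell[OF y(2,3) g(2)]])
next
  show "tambara_unit \<in> Ob tambara_category" by (rule unit_closed)
next
  fix x y z assume "x \<in> Ob tambara_category" "y \<in> Ob tambara_category" "z \<in> Ob tambara_category"
  then show "tambara_assoc x y z \<in>
      isos tambara_category (tambara_tensor (tambara_tensor x y) z) (tambara_tensor x (tambara_tensor y z))"
    by (rule assoc_in_isos)
next
  fix x x' y y' z z' f g h
  assume "x \<in> Ob tambara_category" "x' \<in> Ob tambara_category" "y \<in> Ob tambara_category"
    "y' \<in> Ob tambara_category" "z \<in> Ob tambara_category" "z' \<in> Ob tambara_category"
    "f \<in> Hom tambara_category x x'" "g \<in> Hom tambara_category y y'" "h \<in> Hom tambara_category z z'"
  then show "tambara_assoc x' y' z' \<cdot> ((f \<star> g) \<star> h) = (f \<star> g \<star> h) \<cdot> tambara_assoc x y z"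
    by (rule assoc_natural)
next
  fix x assume x [simp]: "x \<in> Ob tambara_category"
  show "\<iota> (ob x) \<in> isos tambara_category (tambara_tensor tambara_unit x) x"
    "\<iota> (ob x) \<in> isos tambara_category (tambara_tensor x tambara_unit) x"
    using Id_in_isos[OF x] tensor_unit_left[OF x] tensor_unit_right[OF x] by simp_all
next
  fix x y f
  assume x [simp]: "x \<in> Ob tambara_category" and y [simp]: "y \<in> Ob tambara_category" and f: "f \<in> Hom tambara_category x y"
  show "\<iota> (ob y) \<cdot> (\<iota> (ob tambara_unit) \<star> f) = f \<cdot> \<iota> (ob x)"
    "\<iota> (ob y) \<cdot> (f \<star> \<iota> (ob tambara_unit)) = f \<cdot> \<iota> (ob x)"
    unfolding unit_proj by (rule diagram_eqI, (rule rep_intros Hom_cell[OF x y f] | simp)+)+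
next
  fix w x y z
  assume "w \<in> Ob tambara_category" "x \<in> Ob tambara_category" "y \<in> Ob tambara_category" "z \<in> Ob tambara_category"
  then show "tambara_assoc w x (tambara_tensor y z) \<cdot> tambara_assoc (tambara_tensor w x) y z =
      (\<iota> (ob w) \<star> tambara_assoc x y z) \<cdot> tambara_assoc w (tambara_tensor x y) z \<cdot> (tambara_assoc w x y \<star> \<iota> (ob z))"
    by (rule assoc_pentagon)
qed

end

theorem theorem3p5:
  fixes K :: "('o, 'm, 'c) two_cat"
    and A :: 'o and F :: 'm
    and \<mu> \<eta> \<Delta> \<epsilon> \<tau> \<Phi> :: 'c
  assumes "qb_zero_cell K A F \<mu> \<eta> \<Delta> \<epsilon> \<tau> \<Phi>"
  defines "T \<equiv> quasi_bimonad_data.tambara_category K A F \<mu> \<eta> \<Delta> \<epsilon> \<tau> \<Phi>"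
    and "tens \<equiv> quasi_bimonad_data.tambara_tensor K F \<Delta>"
    and "unit \<equiv> quasi_bimonad_data.tambara_unit K A F \<epsilon>"
    and "assoc \<equiv> quasi_bimonad_data.tambara_assoc K F \<Phi>"
  shows "monoidal_category T tens (HComp K) unit assoc (Id T) (Id T) \<and>
         (\<forall>X \<in> Ob T. tens unit X = X \<and> tens X unit = X)"
proof -
  interpret qb_zero_cell K A F \<mu> \<eta> \<Delta> \<epsilon> \<tau> \<Phi> by fact
  show ?thesis
    unfolding T_def tens_def unit_def assoc_def
    using monoidal_category_tambara tensor_unit_left tensor_unit_right by blast
qed

end
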